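(* Let $F=x_0^{d_0}\cdot x_1^{d_1}\cdots x_n^{d_n}\in K[x_0,\ldots,x_n]$ be a monomial with $d_0\leq d_1\leq\cdots\leq d_n$. Then the cactus rank and the smoothable rank of $F$ coincide and $$cr(F)=sr(F)=(d_0+1)\cdots(d_{n-1}+1).$$ If furthermore $d_n=d_0=d$, i.e. $F=(x_0\cdot x_1\cdots x_n)^d$, then $$r(F)=cr(F)=sr(F)=(d+1)^n.$$
   Context: Here $K$ is the coefficient field, and $T=K[x_0,\ldots,x_n]$. The ring $S=K[y_0,\ldots,y_n]$ is the ring of commuting differential operators acting on $T$, with $y_i$ acting as $\partial/\partial x_i$ (this action is called apolarity). It defines $S$ as a natural homogeneous coordinate ring on the projective space $\mathbf{P}(T_1)$ of $1$-dimensional subspaces of the space $T_1$ of linear forms. The annihilator of a homogeneous form $F\in T$ is the homogeneous ideal $F^{\bot}=\{g\in S : g\cdot F=0\}\subset S$. For a finite (i.e. zero-dimensional) subscheme $\Gamma\subset\mathbf{P}(T_1)$, let $I_\Gamma\subset S$ denote its homogeneous ideal and $\deg\Gamma$ its length; $\Gamma$ is apolar to $F$ if $I_\Gamma\subset F^{\bot}$. The cactus rank, smoothable rank and rank of $F$ are $$cr(F)=\min\{\deg\Gamma \mid \Gamma\subset\mathbf{P}(T_1),\ \dim\Gamma=0,\ I_\Gamma\subset F^{\bot}\},$$ $$sr(F)=\min\{\deg\Gamma \mid \Gamma\subset\mathbf{P}(T_1)\text{ smoothable},\ \dim\Gamma=0,\ I_\Gamma\subset F^{\bot}\},$$ $$r(F)=\min\{\deg\Gamma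 \mid \Gamma\subset\mathbf{P}(T_1)\text{ smooth},\ \dim\Gamma=0,\ I_\Gamma\subset F^{\bot}\}.$$ A finite subscheme is smoothable if it is a flat limit of smooth finite subschemes. *)

theory Defs
  imports "HOL-Algebra.Algebraic_Closure_Type" "HOL-Library.Poly_Mapping"
begin

section \<open>Polynomials in the variables with indices 0, ..., n\<close>

text \<open>
  A polynomial maps exponent vectors to coefficients.  The type has countably many variables;
  the ring in the variables with indices 0, ..., n is singled out by its carrier.  The same type
  serves for the forms being differentiated and for the differential operators.
\<close>

type_synonym 'a mpol = "(nat \<Rightarrow>\<^sub>0 nat) \<Rightarrow>\<^sub>0 'a"

definition var :: "nat \<Rightarrow> 'a::comm_ring_1 mpol" where
  "var i = Poly_Mapping.single (Poly_Mapping.single i 1) 1"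

definition mpols :: "nat \<Rightarrow> 'a::zero mpol set" where
  "mpols n = {f. \<forall>m \<in> Poly_Mapping.keys f. Poly_Mapping.keys m \<subseteq> {..n}}"

definition mpol_ring :: "nat \<Rightarrow> 'a::comm_ring_1 mpol ring" where
  "mpol_ring n = \<lparr> carrier = mpols n, monoid.mult = (*), one = 1, ring.zero = 0, add = (+) \<rparr>"

definition mdeg :: "(nat \<Rightarrow>\<^sub>0 nat) \<Rightarrow> nat" where
  "mdeg m = (\<Sum>i \<in> Poly_Mapping.keys m. Poly_Mapping.lookup m i)"

definition hcomp :: "nat \<Rightarrow> 'a::comm_ring_1 mpol \<Rightarrow> 'a mpol" where
  "hcomp k f = (\<Sum>m \<in> {m \<in> Poly_Mapping.keys f. mdeg m = k}.
     Poly_Mapping.single m (Poly_Mapping.lookup f m))"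

definition scale :: "'a::comm_ring_1 \<Rightarrow> 'a mpol \<Rightarrow> 'a mpol" where
  "scale c f = Poly_Mapping.single 0 c * f"

definition pdiff :: "nat \<Rightarrow> 'a::comm_ring_1 mpol \<Rightarrow> 'a mpol" where
  "pdiff i f = (\<Sum>m \<in> Poly_Mapping.keys f.
     Poly_Mapping.single (m - Poly_Mapping.single i 1)
       (of_nat (Poly_Mapping.lookup m i) * Poly_Mapping.lookup f m))"

text \<open>Evaluation at a point with coordinates in the algebraic closure of the coefficient field.\<close>

definition eval_ac :: "nat \<Rightarrow> 'a::field mpol \<Rightarrow> (nat \<Rightarrow> 'a alg_closure) \<Rightarrow> 'a alg_closure" where
  "eval_ac n f p = (\<Sum>m \<in> Poly_Mapping.keys f.
     to_ac (Poly_Mapping.lookup f m) * (\<Prod>i\<le>n. p i ^ Poly_Mapping.lookup m i))"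

lemma vector_space_scale: "vector_space (scale :: 'a::field \<Rightarrow> 'a mpol \<Rightarrow> 'a mpol)"
  by unfold_locales
    (simp_all add: scale_def distrib_left distrib_right single_add mult_single
      flip: mult.assoc single_one)

lemma mpols_add: "f \<in> mpols n \<Longrightarrow> g \<in> mpols n \<Longrightarrow> f + g \<in> mpols n"
  using keys_add[of f g] by (fastforce simp: mpols_def)

lemma mpols_mult:
  fixes f g :: "'a::comm_ring_1 mpol"
  shows "f \<in> mpols n \<Longrightarrow> g \<in> mpols n \<Longrightarrow> f * g \<in> mpols n"
proof -
  assume fg: "f \<in> mpols n" "g \<in> mpols n"
  have "Poly_Mapping.keys m \<subseteq> {..n}" if m: "m \<in> Poly_Mapping.keys (f * g)" for m
  proof -
    obtain a b where "m = a + b" "a \<in> Poly_Mapping.keys f" "b \<in> Poly_Mapping.keys g"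
      using m keys_mult[of f g] by blast
    then show ?thesis
      using fg keys_add[of a b] unfolding mpols_def by blast
  qed
  then show ?thesis by (simp add: mpols_def)
qed

lemma cring_mpol_ring: "cring (mpol_ring n :: 'a::comm_ring_1 mpol ring)"
proof (intro cringI abelian_groupI comm_monoidI)
  fix f :: "'a mpol"
  assume "f \<in> carrier (mpol_ring n)"
  then have "- f \<in> carrier (mpol_ring n)" "- f \<oplus>\<^bsub>mpol_ring n\<^esub> f = \<zero>\<^bsub>mpol_ring n\<^esub>"
    by (simp_all add: mpol_ring_def mpols_def)
  then show "\<exists>g \<in> carrier (mpol_ring n). g \<oplus>\<^bsub>mpol_ring n\<^esub> f = \<zero>\<^bsub>mpol_ring n\<^esub>" ..
next
  show "\<one>\<^bsub>mpol_ring n\<^esub> \<in> carrier (mpol_ring n :: 'a mpol ring)"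
    by (simp add: mpol_ring_def mpols_def flip: single_one)
qed (simp_all add: mpol_ring_def mpols_add mpols_mult algebra_simps, simp add: mpols_def)


section \<open>Apolarity\<close>

definition diff_monom :: "nat \<Rightarrow> (nat \<Rightarrow>\<^sub>0 nat) \<Rightarrow> 'a::comm_ring_1 mpol \<Rightarrow> 'a mpol" where
  "diff_monom n m F = fold (\<lambda>i. pdiff i ^^ Poly_Mapping.lookup m i) [0..<Suc n] F"

definition apolar_action :: "nat \<Rightarrow> 'a::comm_ring_1 mpol \<Rightarrow> 'a mpol \<Rightarrow> 'a mpol" where
  "apolar_action n g F = (\<Sum>m \<in> Poly_Mapping.keys g.
     scale (Poly_Mapping.lookup g m) (diff_monom n m F))"

definition annihilator :: "nat \<Rightarrow> 'a::comm_ring_1 mpol \<Rightarrow> 'a mpol set" where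
  "annihilator n F = {g \<in> mpols n. apolar_action n g F = 0}"


section \<open>Finite subschemes of projective space\<close>

text \<open>
  Closed subschemes of projective n-space over a field correspond bijectively to saturated
  homogeneous ideals of the polynomial ring in n + 1 variables (the ideal corresponding to a
  subscheme being its homogeneous ideal), and are represented by them.
\<close>

definition homogeneous_ideal :: "nat \<Rightarrow> 'a::comm_ring_1 mpol set \<Rightarrow> bool" where
  "homogeneous_ideal n I \<longleftrightarrow> ideal I (mpol_ring n) \<and> (\<forall>f \<in> I. \<forall>k. hcomp k f \<in> I)"

definition saturation :: "nat \<Rightarrow> 'a::comm_ring_1 mpol set \<Rightarrow> 'a mpol set" where
  "saturation n I = {f \<in> mpols n. \<forall>i\<le>n. \<exists>k. var i ^ k * f \<in> I}"

definition closed_subscheme :: "nat \<Rightarrow> 'a::comm_ring_1 mpol set \<Rightarrow> bool" where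
  "closed_subscheme n I \<longleftrightarrow> homogeneous_ideal n I \<and> saturation n I = I"

definition graded_part :: "nat \<Rightarrow> nat \<Rightarrow> 'a::comm_ring_1 mpol set" where
  "graded_part n k = {f \<in> mpols n. \<forall>m \<in> Poly_Mapping.keys f. mdeg m = k}"

text \<open>The dimension of the degree k part of the homogeneous coordinate ring.\<close>

definition hilbert_function :: "nat \<Rightarrow> 'a::field mpol set \<Rightarrow> nat \<Rightarrow> nat" where
  "hilbert_function n I k =
     vector_space.dim scale (graded_part n k :: 'a mpol set)
     - vector_space.dim scale (graded_part n k \<inter> I)"

text \<open>
  The dimension of a closed subscheme is the degree of its Hilbert polynomial, so it is 0 iff the
  Hilbert polynomial is a nonzero constant (the empty scheme has Hilbert polynomial 0).  That
  constant is then the length of the scheme, i.e. the dimension of its ring of global functions.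
\<close>

definition finite_subscheme :: "nat \<Rightarrow> 'a::field mpol set \<Rightarrow> bool" where
  "finite_subscheme n I \<longleftrightarrow> closed_subscheme n I \<and>
     (\<exists>r > 0. \<forall>\<^sub>F k in sequentially. hilbert_function n I k = r)"

definition scheme_length :: "nat \<Rightarrow> 'a::field mpol set \<Rightarrow> nat" where
  "scheme_length n I = (THE r. \<forall>\<^sub>F k in sequentially. hilbert_function n I k = r)"

text \<open>
  Smoothness over the base field, by the Jacobian criterion at the geometric points: at every
  point p of the scheme with coordinates in the algebraic closure, the Jacobian matrix of the
  ideal has rank n, the codimension of a finite subscheme.  By Euler's formula p always lies in
  the kernel of that (n + 1)-column matrix, so rank n means that the kernel is spanned by p.
\<close>

definition smooth_finite_subscheme :: "nat \<Rightarrow> 'a::field mpol set \<Rightarrow> bool" where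
  "smooth_finite_subscheme n I \<longleftrightarrow> finite_subscheme n I \<and>
     (\<forall>p. (\<exists>i\<le>n. p i \<noteq> 0) \<and> (\<forall>f \<in> I. eval_ac n f p = 0) \<longrightarrow>
       (\<forall>v. (\<forall>f \<in> I. (\<Sum>i\<le>n. v i * eval_ac n (pdiff i f) p) = 0) \<longrightarrow>
         (\<exists>c. \<forall>i\<le>n. v i = c * p i)))"

text \<open>
  Let J be the ideal of a closed subscheme X of projective space over K((t)).  Its closure in
  projective space over K[[t]] is the unique extension of X that is flat over K[[t]]; the ideal
  of the closure consists of the polynomials over K[[t]] that lie in J.  The flat limit of X is
  the special fibre of the closure: reduce that ideal modulo t and saturate.
\<close>

definition flat_limit :: "nat \<Rightarrow> 'a::field fls mpol set \<Rightarrow> 'a mpol set" where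
  "flat_limit n J = saturation n
     {Poly_Mapping.map (\<lambda>s. fps_nth s 0) f | f :: 'a fps mpol.
        f \<in> mpols n \<and> Poly_Mapping.map fps_to_fls f \<in> J}"

definition smoothable :: "nat \<Rightarrow> 'a::field mpol set \<Rightarrow> bool" where
  "smoothable n I \<longleftrightarrow> (\<exists>J :: 'a fls mpol set. smooth_finite_subscheme n J \<and> flat_limit n J = I)"


section \<open>Ranks\<close>

text \<open>
  On the natural numbers, \<^term>\<open>Inf\<close> of a nonempty set is its minimum, while \<^term>\<open>Inf\<close> of the
  empty set is 0.  Lengths of finite subschemes are positive, so a positive value of one of the
  ranks is always attained.
\<close>

definition cactus_rank :: "nat \<Rightarrow> 'a::field mpol \<Rightarrow> nat" where
  "cactus_rank n F = Inf {scheme_length n I | I. finite_subscheme n I \<and> I \<subseteq> annihilator n F}"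

definition smoothable_rank :: "nat \<Rightarrow> 'a::field mpol \<Rightarrow> nat" where
  "smoothable_rank n F =
     Inf {scheme_length n I | I. finite_subscheme n I \<and> smoothable n I \<and> I \<subseteq> annihilator n F}"

definition smooth_rank :: "nat \<Rightarrow> 'a::field mpol \<Rightarrow> nat" where
  "smooth_rank n F =
     Inf {scheme_length n I | I. smooth_finite_subscheme n I \<and> I \<subseteq> annihilator n F}"

end

theory Submission
  imports Defs
begin

text \<open>
  Lower bound (Ranestad and Schreyer): let \<open>I\<close> be the saturated ideal of a scheme of length \<open>r\<close>
  apolar to \<open>F\<close>.  With \<open>\<delta> = d\<^sub>n + 1\<close>, a general combination \<open>g\<close> of the powers \<open>y\<^sub>i\<^sup>\<delta>\<close> is a
  nonzerodivisor modulo \<open>I\<close> and annihilates \<open>F\<close>.  The quotient by \<open>I + (g)\<close> has length \<open>\<delta> r\<close> and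
  maps onto the quotient by the annihilator, whose length is \<open>(d\<^sub>0 + 1) \<cdots> (d\<^sub>n + 1)\<close>.

  Upper bound: all schemes needed are complete intersections cut out by binomials
  \<open>y\<^sub>i\<^bsup>d\<^sub>i + 1\<^esup> - c y\<^sub>n\<^bsup>d\<^sub>i + 1\<^esup>\<close> for \<open>i < n\<close>.  They have length \<open>(d\<^sub>0 + 1) \<cdots> (d\<^bsub>n-1\<^esub> + 1)\<close>, and
  are smooth if \<open>c \<noteq> 0\<close>.  The one with \<open>c = 0\<close> is apolar to \<open>F\<close> and is the flat limit of the one with
  \<open>c = t\<close>; the one with \<open>c = 1\<close> is apolar to \<open>F\<close> if all exponents are equal.
\<close>

section \<open>Linear independence modulo a subspace\<close>

text \<open>Independence of the classes of the \<open>x t\<close> in the quotient by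
  \<open>U\<close>, without forming the quotient. Indexing by \<open>T\<close> makes a repeated
  vector a dependence when \<open>U\<close> is a subspace over a field.\<close>

definition indep_over :: "('a::zero \<Rightarrow> 'b::comm_monoid_add \<Rightarrow> 'b) \<Rightarrow> 'b set \<Rightarrow> 'i set \<Rightarrow> ('i \<Rightarrow> 'b) \<Rightarrow> bool" where
  "indep_over sc U T x \<longleftrightarrow> finite T \<and> (\<forall>u. (\<Sum>t\<in>T. sc (u t) (x t)) \<in> U \<longrightarrow> (\<forall>t\<in>T. u t = 0))"

context vector_space
begin

text \<open>The vectors are added one at a time: if \<open>x s\<close> depended on \<open>B\<close>
  and the vectors before it, a combination with coefficient 1 at \<open>s\<close> would lie in
  \<open>U\<close>.\<close>

lemma indep_over_basis_extend:
  assumes U: "subspace U" and B: "independent B" "B \<subseteq> U" "finite B" and x: "indep_over (*s) U T x"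
  shows "independent (B \<union> x ` T) \<and> finite (B \<union> x ` T) \<and> card (B \<union> x ` T) = card B + card T"
proof -
  have fT: "finite T" and ind: "\<And>u t. (\<Sum>t\<in>T. u t *s x t) \<in> U \<Longrightarrow> t \<in> T \<Longrightarrow> u t = 0"
    using x by (auto simp: indep_over_def)
  have "independent (B \<union> x ` S) \<and> card (B \<union> x ` S) = card B + card S" if "finite S" "S \<subseteq> T" for S
    using that
  proof (induction S rule: finite_induct)
    case empty
    then show ?case using B by simp
  next
    case (insert s S)
    have nin: "x s \<notin> span (B \<union> x ` S)"
    proof
      assume "x s \<in> span (B \<union> x ` S)"
      then obtain b w where bw: "x s = b + w" "b \<in> span B" "w \<in> span (x ` S)"
        unfolding span_Un by blast
      have b: "b \<in> U" using bw(2) span_minimal[OF B(2) U] by blast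
      \<comment> \<open>\<open>R\<close> contains the span of the image of \<open>S\<close> and
        gives its elements coefficients indexed by \<open>S\<close>, as \<open>indep_over\<close>
        demands.\<close>
      define R where "R = {y. \<exists>u. y = (\<Sum>t\<in>S. u t *s x t)}"
      have "x ` S \<subseteq> R"
      proof (intro image_subsetI)
        fix t assume "t \<in> S"
        then have "(\<Sum>r\<in>S. (if r = t then 1 else 0) *s x r) = (\<Sum>r\<in>{t}. x r)"
          using insert.hyps(1) by (intro sum.mono_neutral_cong_right) auto
        then have "x t = (\<Sum>r\<in>S. (if r = t then 1 else 0) *s x r)" by simp
        then show "x t \<in> R" unfolding R_def by (intro CollectI exI)
      qed
      moreover have "subspace R"
      proof (rule subspaceI)
        have "0 = (\<Sum>t\<in>S. 0 *s x t)" by simp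
        then show "0 \<in> R" unfolding R_def by (intro CollectI exI)
      next
        fix a b assume "a \<in> R" "b \<in> R"
        then obtain u v where "a = (\<Sum>t\<in>S. u t *s x t)" "b = (\<Sum>t\<in>S. v t *s x t)"
          unfolding R_def by auto
        then have "a + b = (\<Sum>t\<in>S. (u t + v t) *s x t)"
          by (simp add: scale_left_distrib sum.distrib)
        then show "a + b \<in> R" unfolding R_def by (intro CollectI exI)
      next
        fix c a assume "a \<in> R"
        then obtain u where "a = (\<Sum>t\<in>S. u t *s x t)" unfolding R_def by auto
        then have "c *s a = (\<Sum>t\<in>S. (c * u t) *s x t)" by (simp add: scale_sum_right)
        then show "c *s a \<in> R" unfolding R_def by (intro CollectI exI)
      qed
      ultimately obtain u where u: "w = (\<Sum>t\<in>S. u t *s x t)"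
        using bw(3) span_minimal[of "x ` S" R] unfolding R_def by blast
      \<comment> \<open>The coefficients of \<open>x s - w\<close>, which equals \<open>b\<close>
        and so lies in \<open>U\<close>.\<close>
      define v where "v t = (if t = s then 1 else if t \<in> S then - u t else 0)" for t
      have "(\<Sum>t\<in>T. v t *s x t) = (\<Sum>t\<in>insert s S. v t *s x t)"
        using insert.prems fT by (intro sum.mono_neutral_right) (auto simp: v_def)
      also have "\<dots> = x s + (\<Sum>t\<in>S. (- u t) *s x t)"
        using insert.hyps by (auto simp: v_def intro!: sum.cong)
      also have "\<dots> = b" using bw(1) u by (simp add: sum_negf)
      finally have "v s = 0" using b ind[of v s] insert.prems by simp
      then show False by (simp add: v_def)
    qed
    have IH: "independent (B \<union> x ` S)" "card (B \<union> x ` S) = card B + card S"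
      using insert.IH insert.prems by auto
    have eq: "B \<union> x ` insert s S = insert (x s) (B \<union> x ` S)" by auto
    have "x s \<notin> B \<union> x ` S"
      using nin span_superset by (rule contra_subsetD[rotated])
    then have "card (insert (x s) (B \<union> x ` S)) = card B + card (insert s S)"
      using IH(2) insert.hyps B(3) by simp
    then show ?case
      unfolding eq using independent_insertI[OF nin IH(1)] by simp
  qed
  from this[OF fT order_refl] show ?thesis using fT B(3) by simp
qed

text \<open>A basis of \<open>U\<close> and the \<open>x t\<close> are jointly independent in
  \<open>V\<close>. The finite set \<open>S\<close> matters because \<open>dim\<close> of an
  infinite-dimensional space is 0.\<close>

lemma indep_over_card_le:
  assumes "subspace U" "U \<subseteq> V" "V \<subseteq> span S" "finite S" "indep_over (*s) U T x" "x ` T \<subseteq> V"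
  shows "card T + dim U \<le> dim V"
proof -
  obtain B where B: "B \<subseteq> U" "independent B" "U \<subseteq> span B" "card B = dim U"
    using basis_exists by blast
  have fB: "finite B"
    using independent_span_bound[OF assms(4) B(2)] B(1) assms(2,3) by blast
  have *: "independent (B \<union> x ` T)" "card (B \<union> x ` T) = card B + card T"
    using indep_over_basis_extend[OF assms(1) B(2,1) fB assms(5)] by auto
  have "B \<union> x ` T \<subseteq> V" using B(1) assms(2,6) by blast
  then obtain C where C: "B \<union> x ` T \<subseteq> C" "C \<subseteq> V" "independent C" "V \<subseteq> span C"
    using maximal_independent_subset_extend[OF _ *(1)] by blast
  have "finite C" using independent_span_bound[OF assms(4) C(3)] C(2) assms(3) by blast
  then have "card (B \<union> x ` T) \<le> card C" using C(1) card_mono by blast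
  also have "card C = dim V" using basis_card_eq_dim[OF C(2,4,3)] .
  finally show ?thesis using *(2) B(4) by simp
qed

text \<open>\<open>T\<close> consists of the vectors that extend a basis of \<open>U\<close> to a
  basis of \<open>V\<close>.\<close>

lemma indep_over_exists:
  assumes U: "subspace U" and "U \<subseteq> V" "V \<subseteq> span S" "finite S"
  obtains T where "T \<subseteq> V" "indep_over (*s) U T (\<lambda>t. t)" "card T + dim U = dim V"
proof -
  obtain B where B: "B \<subseteq> U" "independent B" "U \<subseteq> span B" "card B = dim U"
    using basis_exists by blast
  obtain C where C: "B \<subseteq> C" "C \<subseteq> V" "independent C" "V \<subseteq> span C"
    using maximal_independent_subset_extend[OF _ B(2), of V] B(1) assms(2) by blast
  have fC: "finite C" using independent_span_bound[OF assms(4) C(3)] C(2) assms(3) by blast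
  then have fB: "finite B" using C(1) finite_subset by blast
  have "indep_over (*s) U (C - B) (\<lambda>t. t)"
    unfolding indep_over_def
  proof (intro conjI allI impI ballI)
    fix u t
    assume "(\<Sum>t\<in>C - B. u t *s t) \<in> U" and t: "t \<in> C - B"
    then have "(\<Sum>t\<in>C - B. u t *s t) \<in> span B" using B(3) by blast
    then obtain w where w: "(\<Sum>t\<in>C - B. u t *s t) = (\<Sum>t\<in>B. w t *s t)"
      unfolding span_finite[OF fB] by auto
    \<comment> \<open>Moving the right-hand side over gives a relation \<open>v\<close> on the basis
      \<open>C\<close>.\<close>
    define v where "v t = (if t \<in> B then - w t else u t)" for t
    have "(\<Sum>t\<in>C. v t *s t) = (\<Sum>t\<in>C - B. v t *s t) + (\<Sum>t\<in>B. v t *s t)"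
      using C(1) fC by (rule sum.subset_diff)
    also have "\<dots> = (\<Sum>t\<in>C - B. u t *s t) + (\<Sum>t\<in>B. (- w t) *s t)"
      by (auto simp: v_def intro!: arg_cong2[of _ _ _ _ "(+)"] sum.cong)
    also have "\<dots> = 0" using w by (simp add: sum_negf)
    finally have "v t = 0" using independentD[OF C(3) fC] t by blast
    then show "u t = 0" using t by (simp add: v_def)
  qed (use fC in simp)
  moreover have "card (C - B) + dim U = dim V"
    using C(1) B(4) fB fC basis_card_eq_dim[OF C(2,4,3)] card_mono[of C B] by (simp add: card_Diff_subset)
  ultimately show ?thesis using that[of "C - B"] C(2) by blast
qed

text \<open>By \<open>gen\<close>, a basis of \<open>U\<close> and the \<open>x t\<close> together
  also span \<open>V\<close>, which gives the inequality missing from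
  \<open>indep_over_card_le\<close>.\<close>

lemma indep_over_spanning_card:
  assumes U: "subspace U" and V: "subspace V" "U \<subseteq> V" "V \<subseteq> span S" "finite S"
    and x: "indep_over (*s) U T x" "x ` T \<subseteq> V"
    and gen: "\<And>v. v \<in> V \<Longrightarrow> \<exists>u w. u \<in> U \<and> w \<in> span (x ` T) \<and> v = u + w"
  shows "card T + dim U = dim V"
proof (rule antisym)
  show "card T + dim U \<le> dim V"
    using indep_over_card_le[OF U V(2-4) x] .
  obtain B where B: "B \<subseteq> U" "independent B" "U \<subseteq> span B" "card B = dim U"
    using basis_exists by blast
  have fB: "finite B"
    using independent_span_bound[OF assms(5) B(2)] B(1) assms(3,4) by blast
  have *: "finite (B \<union> x ` T)" "card (B \<union> x ` T) = card B + card T"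
    using indep_over_basis_extend[OF U B(2,1) fB x(1)] by auto
  have "V \<subseteq> span (B \<union> x ` T)"
  proof
    fix v assume "v \<in> V"
    then obtain u w where "u \<in> U" "w \<in> span (x ` T)" "v = u + w" using gen by blast
    then show "v \<in> span (B \<union> x ` T)" unfolding span_Un using B(3) by blast
  qed
  then show "dim V \<le> card T + dim U"
    using dim_le_card[OF _ *(1)] *(2) B(4) by (metis add.commute)
qed

end

section \<open>Polynomials and their monomials\<close>

abbreviation "lookup \<equiv> Poly_Mapping.lookup"
abbreviation "keys \<equiv> Poly_Mapping.keys"
abbreviation "single \<equiv> Poly_Mapping.single"

text \<open>Restricting the \<open>single\<close> case to monomials of \<open>f\<close> makes a
  hypothesis on the keys of \<open>f\<close> available there, without carrying it through the
  sums.\<close>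

lemma mpol_induct [case_names zero single add]:
  fixes f :: "'a::comm_monoid_add mpol"
  assumes zero: "P 0" and single: "\<And>m x. m \<in> keys f \<Longrightarrow> P (single m x)"
    and add: "\<And>g h. P g \<Longrightarrow> P h \<Longrightarrow> P (g + h)"
  shows "P f"
proof -
  have "f = (\<Sum>m\<in>keys f. single m (lookup f m))"
    by (rule poly_mapping_eqI)
      (simp add: lookup_sum lookup_single when_def in_keys_iff sum.delta)
  moreover have "P (\<Sum>m\<in>A. single m (lookup f m))" if "finite A" "A \<subseteq> keys f" for A
    using that by (induction A rule: finite_induct) (simp_all add: assms)
  ultimately show ?thesis
    by (metis finite_keys order_refl)
qed

text \<open>Yields the additivity of \<open>mdeg\<close>, \<open>nf\<close>, \<open>hcomp\<close>,
  \<open>pdiff\<close> and \<open>eval_ac\<close>, all of them sums over keys. Cancellation in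
  \<open>f + g\<close> does no harm because \<open>\<phi> m 0 = 0\<close>.\<close>

lemma sum_keys_add:
  fixes \<phi> :: "'k \<Rightarrow> 'b::comm_monoid_add \<Rightarrow> 'c::comm_monoid_add"
  assumes "\<And>m. \<phi> m 0 = 0" and "\<And>m x y. \<phi> m (x + y) = \<phi> m x + \<phi> m y"
  shows "(\<Sum>m\<in>keys (f + g). \<phi> m (lookup (f + g) m)) =
    (\<Sum>m\<in>keys f. \<phi> m (lookup f m)) + (\<Sum>m\<in>keys g. \<phi> m (lookup g m))"
  by (rule setsum_keys_plus_distrib) (simp_all add: assms)

lemma sum_keys_single:
  "\<phi> m 0 = 0 \<Longrightarrow> (\<Sum>k\<in>keys (single m x). \<phi> k (lookup (single m x) k)) = \<phi> m x"
  by (cases "x = 0") simp_all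

section \<open>Degrees and graded parts\<close>

lemma mdeg_add: "mdeg (a + b) = mdeg a + mdeg b"
  unfolding mdeg_def by (rule sum_keys_add) simp_all

lemma mdeg_single [simp]: "mdeg (single i k) = k"
  unfolding mdeg_def by (rule sum_keys_single) simp

lemma mdeg_sum: "mdeg (\<Sum>i\<in>A. f i) = (\<Sum>i\<in>A. mdeg (f i))"
  by (induction A rule: infinite_finite_induct) (simp_all add: mdeg_add mdeg_def[of 0])

lemma mdeg_eq_sum: "keys m \<subseteq> {..n} \<Longrightarrow> mdeg m = (\<Sum>i\<le>n. lookup m i)"
  unfolding mdeg_def by (intro sum.mono_neutral_left) (auto simp: in_keys_iff)

definition monomials :: "nat \<Rightarrow> nat \<Rightarrow> (nat \<Rightarrow>\<^sub>0 nat) set" where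
  "monomials n k = {m. keys m \<subseteq> {..n} \<and> mdeg m = k}"

lemma finite_monomials: "finite (monomials n k)"
proof -
  let ?F = "{f. \<forall>i. (i \<in> {..n} \<longrightarrow> f i \<in> {..k}) \<and> (i \<notin> {..n} \<longrightarrow> f i = (0::nat))}"
  have "lookup m \<in> ?F" if m: "m \<in> monomials n k" for m
  proof -
    have "lookup m i \<le> k" if "i \<le> n" for i
      using m that mdeg_eq_sum[of m n] member_le_sum[of i "{..n}" "lookup m"]
      by (auto simp: monomials_def)
    moreover have "lookup m i = 0" if "\<not> i \<le> n" for i
      using m that by (auto simp: monomials_def in_keys_iff)
    ultimately show ?thesis by auto
  qed
  moreover have "finite ?F" by (rule finite_set_of_finite_funs) simp_all
  ultimately have "finite (lookup ` monomials n k)"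
    by (meson finite_subset image_subsetI)
  moreover have "inj_on lookup (monomials n k)"
    by (rule inj_onI) (rule poly_mapping_eqI, rule fun_cong)
  ultimately show ?thesis by (rule finite_imageD)
qed

lemma graded_part_eq: "graded_part n k = {f. keys f \<subseteq> monomials n k}"
  by (auto simp: graded_part_def mpols_def monomials_def)

lemma graded_part_subset_mpols: "graded_part n k \<subseteq> mpols n"
  by (auto simp: graded_part_def)

lemma single_in_mpols: "keys m \<subseteq> {..n} \<Longrightarrow> single m x \<in> mpols n"
  by (simp add: mpols_def)

lemma zero_in_mpols: "0 \<in> mpols n"
  by (simp add: mpols_def)

lemma single_in_graded_part: "m \<in> monomials n k \<Longrightarrow> single m x \<in> graded_part n k"
  by (simp add: graded_part_eq)

lemma graded_part_add: "f \<in> graded_part n k \<Longrightarrow> g \<in> graded_part n k \<Longrightarrow> f + g \<in> graded_part n k"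
  using keys_add[of f g] by (auto simp: graded_part_eq)

lemma graded_part_sum:
  "(\<And>i. i \<in> A \<Longrightarrow> f i \<in> graded_part n k) \<Longrightarrow> (\<Sum>i\<in>A. f i) \<in> graded_part n k"
  by (induction A rule: infinite_finite_induct)
    (simp_all add: graded_part_add, simp_all add: graded_part_eq)

lemma graded_part_mult:
  fixes f g :: "'a::comm_ring_1 mpol"
  assumes "f \<in> graded_part n j" "g \<in> graded_part n k"
  shows "f * g \<in> graded_part n (j + k)"
  unfolding graded_part_eq
proof (intro CollectI subsetI)
  fix m assume "m \<in> keys (f * g)"
  then obtain a b where "m = a + b" "a \<in> keys f" "b \<in> keys g"
    using keys_mult[of f g] by blast
  then show "m \<in> monomials n (j + k)"
    using assms keys_add[of a b] by (fastforce simp: graded_part_eq monomials_def mdeg_add)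
qed

lemma var_power: "var i ^ k = (single (single i k) 1 :: 'a::comm_ring_1 mpol)"
  by (induction k) (simp_all add: var_def mult_single flip: single_add)

lemma var_power_in_graded_part:
  "i \<le> n \<Longrightarrow> (var i ^ k :: 'a::comm_ring_1 mpol) \<in> graded_part n k"
  by (auto simp: var_power monomials_def intro!: single_in_graded_part)

section \<open>Polynomials as a vector space\<close>

lemma scale_single: "scale c (single m x) = single m (c * x)"
  by (simp add: scale_def mult_single)

lemma lookup_scale: "lookup (scale c f) m = c * lookup f m"
  unfolding scale_def by (subst mult_map_scale_conv_mult [symmetric]) (simp add: map.rep_eq when_def)

lemma scale_mult_right: "f * scale c g = scale c (f * g)"
  by (simp add: scale_def mult.left_commute)

lemma keys_scale: "keys (scale c f) \<subseteq> keys f"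
  by (auto simp: in_keys_iff lookup_scale)

interpretation mpol: vector_space "scale :: 'a::field \<Rightarrow> 'a mpol \<Rightarrow> 'a mpol"
  by (rule vector_space_scale)

lemma graded_part_scale: "f \<in> graded_part n k \<Longrightarrow> scale c f \<in> graded_part n k"
  using keys_scale by (fastforce simp: graded_part_eq)

lemma subspace_graded_part: "mpol.subspace (graded_part n k)"
  by (rule mpol.subspaceI)
    (simp_all add: graded_part_add graded_part_scale, simp add: graded_part_eq)

lemma in_span_monomials:
  fixes f :: "'a::field mpol"
  assumes "keys f \<subseteq> M"
  shows "f \<in> mpol.span ((\<lambda>m. single m 1) ` M)"
proof (induction f rule: mpol_induct)
  case (single m x)
  then have "single m 1 \<in> (\<lambda>m. single m (1::'a)) ` M" using assms by blast
  then have "scale x (single m 1) \<in> mpol.span ((\<lambda>m. single m 1) ` M)"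
    by (intro mpol.span_scale mpol.span_base)
  then show ?case by (simp add: scale_single)
qed (simp_all add: mpol.span_zero mpol.span_add)

lemma graded_part_finite_span:
  "graded_part n k \<subseteq> mpol.span ((\<lambda>m. single m (1::'a::field)) ` monomials n k)"
  using in_span_monomials by (auto simp: graded_part_eq)

lemma lookup_sum_scale_single:
  assumes "finite T" "inj_on g T" "t \<in> T"
  shows "lookup (\<Sum>m\<in>T. scale (u m) (single (g m) 1)) (g t) = u t"
proof -
  have "lookup (\<Sum>m\<in>T. scale (u m) (single (g m) 1)) (g t)
      = (\<Sum>m\<in>T. if m = t then u m else 0)"
    unfolding lookup_sum scale_single lookup_single when_def
    using inj_onD[OF assms(2)] assms(3) by (intro sum.cong) auto
  then show ?thesis using assms by simp
qed

subsection \<open>Ideals\<close>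

lemma ideal_mpol_ringD:
  fixes I :: "'a::comm_ring_1 mpol set"
  assumes "ideal I (mpol_ring n)"
  shows "I \<subseteq> mpols n" "0 \<in> I"
    and "\<And>f g. f \<in> I \<Longrightarrow> g \<in> I \<Longrightarrow> f + g \<in> I"
    and "\<And>f g. f \<in> mpols n \<Longrightarrow> g \<in> I \<Longrightarrow> f * g \<in> I"
proof -
  interpret I: ideal I "mpol_ring n" by fact
  show "I \<subseteq> mpols n" using I.a_subset by (simp add: mpol_ring_def)
  show "0 \<in> I" using additive_subgroup.zero_closed[OF I.additive_subgroup_axioms]
    by (simp add: mpol_ring_def)
  show "f + g \<in> I" if "f \<in> I" "g \<in> I" for f g
    using additive_subgroup.a_closed[OF I.additive_subgroup_axioms that] by (simp add: mpol_ring_def)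
  show "f * g \<in> I" if "f \<in> mpols n" "g \<in> I" for f g
    using I.I_l_closed[of g f] that by (simp add: mpol_ring_def)
qed

lemma ideal_mpol_ringI:
  fixes I :: "'a::comm_ring_1 mpol set"
  assumes "I \<subseteq> mpols n" "0 \<in> I" "\<And>f g. f \<in> I \<Longrightarrow> g \<in> I \<Longrightarrow> f + g \<in> I"
    and mult: "\<And>f g. f \<in> mpols n \<Longrightarrow> g \<in> I \<Longrightarrow> f * g \<in> I"
  shows "ideal I (mpol_ring n)"
proof -
  interpret cring "mpol_ring n :: 'a mpol ring" by (rule cring_mpol_ring)
  have neg: "\<ominus>\<^bsub>mpol_ring n\<^esub> f = - f" if "f \<in> mpols n" for f :: "'a mpol"
    using that by (intro minus_equality) (simp_all add: mpol_ring_def mpols_def)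
  have "- f \<in> I" if "f \<in> I" for f
  proof -
    \<comment> \<open>Closure under negation comes from multiplication by the constant -1.\<close>
    have "single 0 (- 1) * f = - f"
      by (simp only: single_uminus single_one mult_minus_left mult_1_left)
    then show ?thesis
      using mult[of "single 0 (- 1)" f] that by (metis empty_subsetI keys_zero single_in_mpols)
  qed
  then have sub: "subgroup I (add_monoid (mpol_ring n))"
    using assms neg
    by (intro add.subgroupI) (auto simp: mpol_ring_def a_inv_def[symmetric])
  show ?thesis
  proof (rule idealI)
    show "ring (mpol_ring n :: 'a mpol ring)" by (rule ring_axioms)
    show "subgroup I (add_monoid (mpol_ring n))" by (rule sub)
  next
    fix g f :: "'a mpol"
    assume "g \<in> I" "f \<in> carrier (mpol_ring n)"
    then have "f * g \<in> I" using mult by (simp add: mpol_ring_def)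
    then show "f \<otimes>\<^bsub>mpol_ring n\<^esub> g \<in> I" "g \<otimes>\<^bsub>mpol_ring n\<^esub> f \<in> I"
      by (simp_all add: mpol_ring_def mult.commute)
  qed
qed

section \<open>Binomial complete intersections\<close>

text \<open>
  Rewriting \<open>y\<^sub>i\<^bsup>e i\<^esup>\<close> to \<open>c y\<^sub>n\<^bsup>e i\<^esup>\<close> for all \<open>i < n\<close> takes the monomial with exponent vector \<open>m\<close> to
  \<open>c ^ red_weight n e m\<close> times the one with exponent vector \<open>red n e m\<close>.  The kernel of this normal form
  is the ideal generated by the binomials \<open>y\<^sub>i\<^bsup>e i\<^esup> - c y\<^sub>n\<^bsup>e i\<^esup>\<close>, and taking it as the definition
  makes membership a linear condition.
\<close>

definition red :: "nat \<Rightarrow> (nat \<Rightarrow> nat) \<Rightarrow> (nat \<Rightarrow>\<^sub>0 nat) \<Rightarrow> (nat \<Rightarrow>\<^sub>0 nat)" where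
  "red n e m = (\<Sum>i<n. single i (lookup m i mod e i))
     + single n (lookup m n + (\<Sum>i<n. e i * (lookup m i div e i)))"

definition red_weight :: "nat \<Rightarrow> (nat \<Rightarrow> nat) \<Rightarrow> (nat \<Rightarrow>\<^sub>0 nat) \<Rightarrow> nat" where
  "red_weight n e m = (\<Sum>i<n. lookup m i div e i)"

definition nf :: "nat \<Rightarrow> (nat \<Rightarrow> nat) \<Rightarrow> 'a::comm_ring_1 \<Rightarrow> 'a mpol \<Rightarrow> 'a mpol" where
  "nf n e c f = (\<Sum>m\<in>keys f. single (red n e m) (c ^ red_weight n e m * lookup f m))"

text \<open>The monomials to which no rewriting applies. If all \<open>e i\<close> with
  \<open>i < n\<close> are positive, their classes form a basis of the quotient by the ideal
  below.\<close>

definition standard :: "nat \<Rightarrow> (nat \<Rightarrow> nat) \<Rightarrow> (nat \<Rightarrow>\<^sub>0 nat) \<Rightarrow> bool" where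
  "standard n e m \<longleftrightarrow> keys m \<subseteq> {..n} \<and> (\<forall>i<n. lookup m i < e i)"

definition binomial_ideal :: "nat \<Rightarrow> (nat \<Rightarrow> nat) \<Rightarrow> 'a::comm_ring_1 \<Rightarrow> 'a mpol set" where
  "binomial_ideal n e c = {f \<in> mpols n. nf n e c f = 0}"

lemma single_ne_0: "x \<noteq> 0 \<Longrightarrow> single m x \<noteq> 0"
  by (metis lookup_single_eq lookup_zero)

section \<open>Reduction of exponent vectors\<close>

lemma lookup_red:
  "lookup (red n e m) i = (if i < n then lookup m i mod e i
     else if i = n then lookup m n + (\<Sum>i<n. e i * (lookup m i div e i)) else 0)"
  unfolding red_def lookup_add lookup_sum lookup_single when_def by (auto simp: sum.delta')

lemma keys_red: "keys (red n e m) \<subseteq> {..n}"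
  by (auto simp: in_keys_iff lookup_red split: if_splits)

lemma add_div_eq_mod_div: "(x + y) div k = (x + y mod k) div k + y div k" for x y k :: nat
proof (cases "k = 0")
  case False
  have "x + y = x + y mod k + y div k * k" by (simp add: mult.commute)
  then show ?thesis using False by (metis add.commute div_mult_self1)
qed simp

text \<open>Confluence of the rewriting: \<open>b\<close> may be reduced before or after
  \<open>a\<close> is added, since the quotients by \<open>e i\<close> in the two stages add up to
  the quotient of the whole.\<close>

lemma red_add: "red n e (a + red n e b) = red n e (a + b)"
proof (rule poly_mapping_eqI)
  fix j
  have "e i * (lookup b i div e i) + e i * ((lookup a i + lookup b i mod e i) div e i)
      = e i * ((lookup a i + lookup b i) div e i)" for i
    by (simp add: add_div_eq_mod_div[of "lookup a i" "lookup b i" "e i"] distrib_left)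
  then have "(\<Sum>i<n. e i * (lookup b i div e i))
      + (\<Sum>i<n. e i * ((lookup a i + lookup b i mod e i) div e i))
      = (\<Sum>i<n. e i * ((lookup a i + lookup b i) div e i))"
    by (simp flip: sum.distrib)
  then show "lookup (red n e (a + red n e b)) j = lookup (red n e (a + b)) j"
    by (simp add: lookup_red lookup_add mod_add_right_eq)
qed

text \<open>The two-stage count of rewriting steps is the total count, so the powers of
  \<open>c\<close> agree as well.\<close>

lemma red_weight_add: "red_weight n e (a + b) = red_weight n e (a + red n e b) + red_weight n e b"
  unfolding red_weight_def sum.distrib [symmetric]
  by (intro sum.cong) (simp_all add: lookup_add lookup_red, rule add_div_eq_mod_div)

lemma standard_red: "(\<And>i. i < n \<Longrightarrow> 0 < e i) \<Longrightarrow> standard n e (red n e m)"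
  by (auto simp: standard_def keys_red lookup_red subsetD[OF keys_red])

lemma standardD:
  assumes "standard n e m"
  shows "red n e m = m" "red_weight n e m = 0"
proof -
  have *: "lookup m i mod e i = lookup m i" "lookup m i div e i = 0" if "i < n" for i
    using assms that by (auto simp: standard_def)
  have "lookup m i = 0" if "i > n" for i
    using assms that by (auto simp: standard_def in_keys_iff)
  then show "red n e m = m"
    by (intro poly_mapping_eqI) (auto simp: lookup_red *)
  show "red_weight n e m = 0"
    by (simp add: red_weight_def *)
qed

lemma red_weight_eq_0D:
  assumes "red_weight n e m = 0" "keys m \<subseteq> {..n}"
  shows "red n e m = m"
proof (rule poly_mapping_eqI)
  fix i
  have *: "lookup m i div e i = 0" if "i < n" for i
    using assms that by (auto simp: red_weight_def)
  then have "lookup m i mod e i = lookup m i" if "i < n" for i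
    using that by (metis add.right_neutral div_mult_mod_eq mult_0 add_0)
  moreover have "lookup m i = 0" if "i > n"
    using assms that by (auto simp: in_keys_iff)
  ultimately show "lookup (red n e m) i = lookup m i"
    using * by (auto simp: lookup_red)
qed

text \<open>Each rewriting step trades \<open>e i\<close> factors \<open>y_i\<close> for as many
  factors \<open>y_n\<close>.\<close>

lemma mdeg_red: "keys m \<subseteq> {..n} \<Longrightarrow> mdeg (red n e m) = mdeg m"
proof -
  assume m: "keys m \<subseteq> {..n}"
  have "mdeg (red n e m) = (\<Sum>i<n. lookup m i mod e i + e i * (lookup m i div e i)) + lookup m n"
    unfolding red_def sum.distrib mdeg_add mdeg_sum mdeg_single by (simp only: ac_simps)
  also have "\<dots> = mdeg m"
    unfolding mod_mult_div_eq mdeg_eq_sum[OF m] by (simp flip: lessThan_Suc_atMost)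
  finally show ?thesis .
qed

section \<open>Normal forms of polynomials\<close>

lemma nf_single: "nf n e c (single m x) = single (red n e m) (c ^ red_weight n e m * x)"
  unfolding nf_def by (rule sum_keys_single) simp

lemma nf_add: "nf n e c (f + g) = nf n e c f + nf n e c g"
  unfolding nf_def by (rule sum_keys_add) (simp_all add: algebra_simps single_add)

lemma nf_0 [simp]: "nf n e c 0 = 0"
  by (simp add: nf_def)

lemma nf_diff: "nf n e c (f - g) = nf n e c f - nf n e c g"
  using nf_add[of n e c "f - g" g] by (simp add: algebra_simps)

text \<open>The normal form of a product depends only on the normal forms of its factors. Hence the
  kernel of \<open>nf\<close> is an ideal and, with first factor 1, \<open>nf\<close> is
  idempotent.\<close>

lemma nf_mult_nf: "nf n e c (f * nf n e c g) = nf n e c (f * g)"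
proof (induction f rule: mpol_induct)
  case (single m x)
  show ?case
  proof (induction g rule: mpol_induct)
    case (single b y)
    have "c ^ red_weight n e (m + red n e b) * (x * (c ^ red_weight n e b * y))
        = c ^ red_weight n e (m + b) * (x * y)"
      unfolding red_weight_add[of n e m b] power_add by (simp add: mult_ac)
    then show ?case by (simp add: nf_single mult_single red_add)
  qed (simp_all add: nf_add distrib_left)
qed (simp_all add: nf_add distrib_right)

lemma nf_in_mpols: "nf n e c f \<in> mpols n"
  by (induction f rule: mpol_induct)
    (simp_all add: nf_single nf_add mpols_add single_in_mpols keys_red zero_in_mpols)

lemma keys_nf:
  assumes "\<And>i. i < n \<Longrightarrow> 0 < e i"
  shows "keys (nf n e c f) \<subseteq> Collect (standard n e)"
proof (induction f rule: mpol_induct)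
  case (single m x)
  then show ?case by (simp add: nf_single standard_red assms)
next
  case (add g h)
  then show ?case using keys_add[of "nf n e c g" "nf n e c h"] by (auto simp: nf_add)
qed simp

lemma nf_standard:
  assumes "keys f \<subseteq> Collect (standard n e)"
  shows "nf n e c f = f"
proof (induction f rule: mpol_induct)
  case (single m x)
  then have "standard n e m" using assms by auto
  then show ?case by (simp add: nf_single standardD)
qed (simp_all add: nf_add)

lemma nf_nf: "nf n e c (nf n e c f) = nf n e c f"
  using nf_mult_nf[of n e c 1 f] by simp

lemma nf_graded_part:
  assumes "f \<in> graded_part n k"
  shows "nf n e c f \<in> graded_part n k"
proof (induction f rule: mpol_induct)
  case (single m x)
  then have "red n e m \<in> monomials n k"
    using assms keys_red by (auto simp: graded_part_eq monomials_def mdeg_red)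
  then show ?case by (simp add: nf_single single_in_graded_part)
next
  case (add g h)
  then show ?case by (simp add: nf_add graded_part_add)
qed (simp add: graded_part_eq)

section \<open>Homogeneous components\<close>

lemma hcomp_eq_sum: "hcomp k f = (\<Sum>m\<in>keys f. if mdeg m = k then single m (lookup f m) else 0)"
  unfolding hcomp_def by (rule sum.inter_filter) simp

lemma hcomp_single: "hcomp k (single m x) = (if mdeg m = k then single m x else 0)"
  unfolding hcomp_eq_sum by (rule sum_keys_single) simp

lemma hcomp_add: "hcomp k (f + g) = hcomp k f + hcomp k g"
  unfolding hcomp_eq_sum by (rule sum_keys_add) (simp_all add: single_add)

lemma hcomp_0 [simp]: "hcomp k 0 = 0"
  by (simp add: hcomp_def)

lemma nf_hcomp: "f \<in> mpols n \<Longrightarrow> nf n e c (hcomp k f) = hcomp k (nf n e c f)"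
proof -
  assume f: "f \<in> mpols n"
  show ?thesis
  proof (induction f rule: mpol_induct)
    case (single m x)
    then have "mdeg (red n e m) = mdeg m" using f by (intro mdeg_red) (auto simp: mpols_def)
    then show ?case by (simp add: hcomp_single nf_single)
  qed (simp_all add: hcomp_add nf_add)
qed

lemma hcomp_in_mpols: "f \<in> mpols n \<Longrightarrow> hcomp k f \<in> mpols n"
proof -
  assume f: "f \<in> mpols n"
  show ?thesis
  proof (induction f rule: mpol_induct)
    case (single m x)
    then show ?case using f by (auto simp: hcomp_single mpols_def)
  qed (simp_all add: hcomp_add mpols_add zero_in_mpols)
qed

section \<open>The ideal is homogeneous and saturated\<close>

lemma binomial_in_ideal:
  assumes "i < n" "0 < e i"
  shows "single (single i (e i)) 1 - single (single n (e i)) c \<in> binomial_ideal n e c"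
proof -
  have "keys (single (single i (e i)) 1 - single (single n (e i)) c) \<subseteq> {single i (e i), single n (e i)}"
    by (auto simp: in_keys_iff lookup_minus lookup_single when_def split: if_splits)
  then have "single (single i (e i)) 1 - single (single n (e i)) c \<in> mpols n"
    using assms by (auto simp: mpols_def)
  moreover have "red n e (single i (e i)) = single n (e i)"
    using assms by (intro poly_mapping_eqI) (auto simp: lookup_red lookup_single when_def sum.delta'
        if_distrib[of "\<lambda>x. x div _"] if_distrib[of "\<lambda>x. _ * x"] cong: if_cong)
  moreover have "red_weight n e (single i (e i)) = 1"
    using assms by (auto simp: red_weight_def lookup_single when_def sum.delta'
        if_distrib[of "\<lambda>x. x div _"] cong: if_cong)
  moreover have "red n e (single n (e i)) = single n (e i)" "red_weight n e (single n (e i)) = 0"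
    using assms by (auto intro!: poly_mapping_eqI simp: lookup_red red_weight_def lookup_single when_def)
  ultimately show ?thesis
    by (simp add: binomial_ideal_def nf_diff nf_single)
qed

lemma homogeneous_binomial_ideal: "homogeneous_ideal n (binomial_ideal n e (c :: 'a::comm_ring_1))"
  unfolding homogeneous_ideal_def
proof (intro conjI ballI allI ideal_mpol_ringI)
  fix f g :: "'a mpol"
  assume "f \<in> mpols n" "g \<in> binomial_ideal n e c"
  then show "f * g \<in> binomial_ideal n e c"
    using nf_mult_nf[of n e c f g] by (auto simp: binomial_ideal_def mpols_mult)
qed (auto simp: binomial_ideal_def zero_in_mpols mpols_add nf_add hcomp_in_mpols nf_hcomp)

text \<open>\<open>y_n\<close> is a nonzerodivisor modulo the ideal: standard monomials have no
  bound on the exponent of \<open>y_n\<close>, so multiplying a normal form by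
  \<open>y_n ^ k\<close> gives a normal form, which vanishes only if the original one does.\<close>

lemma closed_subscheme_binomial_ideal:
  fixes c :: "'a::idom"
  assumes e: "\<And>i. i < n \<Longrightarrow> 0 < e i"
  shows "closed_subscheme n (binomial_ideal n e c)"
proof -
  have "f \<in> binomial_ideal n e c"
    if "f \<in> mpols n" "var n ^ k * f \<in> binomial_ideal n e c" for f k
  proof -
    have "keys (var n ^ k * nf n e c f) \<subseteq> Collect (standard n e)"
    proof
      fix m assume "m \<in> keys (var n ^ k * nf n e c f)"
      then obtain b where "m = single n k + b" "b \<in> keys (nf n e c f)"
        using keys_mult[of "var n ^ k" "nf n e c f"] by (auto simp: var_power)
      then show "m \<in> Collect (standard n e)"
        using keys_nf[of n e c f] e keys_add[of "single n k" b]
        by (fastforce simp: standard_def lookup_add lookup_single split: if_splits)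
    qed
    then have "var n ^ k * nf n e c f = nf n e c (var n ^ k * f)"
      using nf_standard nf_mult_nf by metis
    moreover have "nf n e c (var n ^ k * f) = 0" using that by (simp add: binomial_ideal_def)
    moreover have "var n ^ k \<noteq> (0 :: 'a mpol)"
      by (simp add: var_power single_ne_0)
    ultimately have "nf n e c f = 0" by (simp del: power_eq_0_iff)
    then show ?thesis using that by (simp add: binomial_ideal_def)
  qed
  moreover have "f \<in> saturation n (binomial_ideal n e c)" if "f \<in> binomial_ideal n e c" for f
    using that by (auto simp: saturation_def binomial_ideal_def intro!: exI[of _ 0])
  ultimately have "saturation n (binomial_ideal n e c) = binomial_ideal n e c"
    by (auto simp: saturation_def)
  then show ?thesis
    by (simp add: closed_subscheme_def homogeneous_binomial_ideal)
qed

subsection \<open>Length\<close>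

text \<open>The exponents at \<open>i < n\<close> range freely below \<open>e i\<close>; the degree
  then forces the exponent at \<open>n\<close>, and \<open>k\<close> is large enough for it to be
  nonnegative.\<close>

lemma card_standard_monomials:
  assumes "(\<Sum>i<n. e i) \<le> k"
  shows "card {m \<in> monomials n k. standard n e m} = (\<Prod>i<n. e i)"
proof -
  define g where "g h = (\<Sum>i<n. single i (h i)) + single n (k - (\<Sum>i<n. h i))" for h :: "nat \<Rightarrow> nat"
  have lg: "lookup (g h) i = (if i < n then h i else if i = n then k - (\<Sum>i<n. h i) else 0)" for h i
    unfolding g_def lookup_add lookup_sum lookup_single when_def by (auto simp: sum.delta')
  have "bij_betw g (PiE {..<n} (\<lambda>i. {..<e i})) {m \<in> monomials n k. standard n e m}"
  proof (rule bij_betwI')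
    fix x y assume "x \<in> PiE {..<n} (\<lambda>i. {..<e i})" "y \<in> PiE {..<n} (\<lambda>i. {..<e i})"
    moreover have "x i = y i" if "g x = g y" "i < n" for i
      using arg_cong[OF that(1), of "\<lambda>m. lookup m i"] that(2) by (simp add: lg)
    ultimately show "(g x = g y) = (x = y)"
      by (metis PiE_ext lessThan_iff)
  next
    fix h assume h: "h \<in> PiE {..<n} (\<lambda>i. {..<e i})"
    then have "(\<Sum>i<n. h i) \<le> (\<Sum>i<n. e i)" by (intro sum_mono) (auto simp: PiE_iff less_imp_le)
    then have "mdeg (g h) = k"
      using assms unfolding g_def by (simp add: mdeg_add mdeg_sum)
    moreover have "keys (g h) \<subseteq> {..n}" by (auto simp: in_keys_iff lg split: if_splits)
    ultimately show "g h \<in> {m \<in> monomials n k. standard n e m}"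
      using h by (auto simp: monomials_def standard_def lg PiE_iff)
  next
    fix m assume m: "m \<in> {m \<in> monomials n k. standard n e m}"
    then have "k = (\<Sum>i<n. lookup m i) + lookup m n"
      using mdeg_eq_sum[of m n] by (auto simp: monomials_def simp flip: lessThan_Suc_atMost)
    then have "m = g (restrict (lookup m) {..<n})"
      using m by (intro poly_mapping_eqI) (auto simp: lg standard_def in_keys_iff)
    then show "\<exists>h \<in> PiE {..<n} (\<lambda>i. {..<e i}). m = g h"
      using m by (intro bexI[of _ "restrict (lookup m) {..<n}"]) (auto simp: standard_def)
  qed
  then show ?thesis
    by (simp add: bij_betw_same_card[symmetric] card_PiE)
qed

lemma subspace_Int_ideal:
  fixes I :: "'a::field mpol set"
  assumes "ideal I (mpol_ring n)"
  shows "mpol.subspace (graded_part n k \<inter> I)"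
proof -
  have "scale c f \<in> I" if "f \<in> I" for c f
    unfolding scale_def using that by (intro ideal_mpol_ringD(4)[OF assms] single_in_mpols) simp_all
  then have "mpol.subspace I"
    using ideal_mpol_ringD[OF assms] by (intro mpol.subspaceI)
  then show ?thesis
    by (intro mpol.subspace_inter subspace_graded_part)
qed

text \<open>The standard monomials of degree \<open>k\<close> are a basis modulo the ideal:
  independent because \<open>nf\<close> fixes their combinations, spanning because
  \<open>f - nf n e c f\<close> lies in the ideal.\<close>

lemma hilbert_function_binomial_ideal:
  fixes c :: "'a::field"
  assumes e: "\<And>i. i < n \<Longrightarrow> 0 < e i"
  shows "hilbert_function n (binomial_ideal n e c) k = card {m \<in> monomials n k. standard n e m}"
proof -
  let ?J = "binomial_ideal n e c" and ?V = "graded_part n k :: 'a mpol set"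
  define T where "T = {m \<in> monomials n k. standard n e m}"
  have fT: "finite T" using finite_monomials by (simp add: T_def)
  have id: "ideal ?J (mpol_ring n)"
    using homogeneous_binomial_ideal by (auto simp: homogeneous_ideal_def)
  have ind: "indep_over scale (?V \<inter> ?J) T (\<lambda>m. single m 1)"
    unfolding indep_over_def
  proof (intro conjI allI impI ballI fT)
    fix u :: "(nat \<Rightarrow>\<^sub>0 nat) \<Rightarrow> 'a" and t
    let ?s = "\<Sum>m\<in>T. scale (u m) (single m 1)"
    assume s: "?s \<in> ?V \<inter> ?J" and t: "t \<in> T"
    have "keys ?s \<subseteq> T"
      using Poly_Mapping.keys_sum[of "\<lambda>m. scale (u m) (single m 1)" T] by (auto simp: scale_single split: if_splits)
    then have "nf n e c ?s = ?s" by (intro nf_standard) (auto simp: T_def)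
    then have "?s = 0" using s by (simp add: binomial_ideal_def)
    then show "u t = 0"
      using lookup_sum_scale_single[OF fT _ t, of "\<lambda>m. m" u] by simp
  qed
  have "card T + mpol.dim (?V \<inter> ?J) = mpol.dim ?V"
  proof (rule mpol.indep_over_spanning_card[OF subspace_Int_ideal[OF id] subspace_graded_part
        _ graded_part_finite_span _ ind])
    show "(\<lambda>m. single m 1) ` T \<subseteq> ?V"
      by (auto simp: T_def single_in_graded_part)
    fix f assume f: "f \<in> ?V"
    have "nf n e c f \<in> ?V" using f by (rule nf_graded_part)
    then have "keys (nf n e c f) \<subseteq> T"
      using keys_nf[of n e c f] e by (auto simp: T_def graded_part_eq)
    then have "nf n e c f \<in> mpol.span ((\<lambda>m. single m 1) ` T)"
      by (rule in_span_monomials)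
    moreover have "f - nf n e c f \<in> ?V"
      using f nf_graded_part[OF f] by (intro mpol.subspace_diff[OF subspace_graded_part])
    moreover from this have "f - nf n e c f \<in> ?J"
      using graded_part_subset_mpols by (auto simp: binomial_ideal_def nf_diff nf_nf)
    ultimately show "\<exists>u w. u \<in> ?V \<inter> ?J \<and> w \<in> mpol.span ((\<lambda>m. single m 1) ` T) \<and> f = u + w"
      by (intro exI[of _ "f - nf n e c f"] exI[of _ "nf n e c f"]) simp
  qed (simp_all add: finite_monomials)
  then show ?thesis by (simp add: hilbert_function_def T_def)
qed

lemma scheme_length_eqI:
  assumes "\<forall>\<^sub>F k in sequentially. hilbert_function n I k = r"
  shows "scheme_length n I = r"
  unfolding scheme_length_def
proof (rule the_equality)
  fix s assume "\<forall>\<^sub>F k in sequentially. hilbert_function n I k = s"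
  then have "\<forall>\<^sub>F k::nat in sequentially. s = r" using assms by eventually_elim simp
  then show "s = r" by simp
qed (rule assms)

lemma finite_subscheme_binomial_ideal:
  fixes c :: "'a::field"
  assumes e: "\<And>i. i < n \<Longrightarrow> 0 < e i"
  shows "finite_subscheme n (binomial_ideal n e c)"
    and "scheme_length n (binomial_ideal n e c) = (\<Prod>i<n. e i)"
proof -
  have *: "\<forall>\<^sub>F k in sequentially. hilbert_function n (binomial_ideal n e c) k = (\<Prod>i<n. e i)"
    using eventually_ge_at_top[of "\<Sum>i<n. e i"]
    by eventually_elim (simp add: hilbert_function_binomial_ideal[OF e] card_standard_monomials)
  then show "scheme_length n (binomial_ideal n e c) = (\<Prod>i<n. e i)"
    by (rule scheme_length_eqI)
  have "(\<Prod>i<n. e i) > 0" using e by (intro prod_pos) auto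
  then show "finite_subscheme n (binomial_ideal n e c)"
    unfolding finite_subscheme_def using * closed_subscheme_binomial_ideal[of n e c] e by blast
qed

section \<open>The annihilator of a monomial\<close>

lemma pdiff_single: "pdiff i (single m x) = single (m - single i 1) (of_nat (lookup m i) * x)"
  unfolding pdiff_def by (rule sum_keys_single) simp

lemma pdiff_add: "pdiff i (f + g) = pdiff i f + pdiff i g"
  unfolding pdiff_def by (rule sum_keys_add) (simp_all add: distrib_left single_add)

lemma pdiff_diff: "pdiff i (f - g) = pdiff i f - pdiff i g"
  using pdiff_add[of i "f - g" g] by (simp add: algebra_simps)

lemma pdiff_funpow_single:
  "(pdiff i ^^ j) (single m x) = single (m - single i j) (of_nat (\<Prod>l<j. lookup m i - l) * x)"
proof (induction j)
  case (Suc j)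
  have "m - single i j - single i 1 = m - single i (Suc j)"
    by (rule poly_mapping_eqI) (simp add: lookup_minus lookup_single when_def)
  then show ?case
    by (simp add: Suc.IH pdiff_single lookup_minus mult_ac)
qed simp

text \<open>A product of falling factorials. Truncated subtraction makes it 0 as soon as one
  exponent of \<open>m\<close> exceeds that of \<open>a\<close>, and then the truncated difference
  \<open>a - m\<close> does not matter.\<close>

definition deriv_coeff :: "nat \<Rightarrow> (nat \<Rightarrow>\<^sub>0 nat) \<Rightarrow> (nat \<Rightarrow>\<^sub>0 nat) \<Rightarrow> nat" where
  "deriv_coeff n m a = (\<Prod>i<Suc n. \<Prod>l<lookup m i. lookup a i - l)"

lemma deriv_coeff_eq_0_iff: "deriv_coeff n m a = 0 \<longleftrightarrow> (\<exists>i\<le>n. lookup a i < lookup m i)"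
proof -
  have "(\<Prod>l<k. b - l) = 0 \<longleftrightarrow> b < k" for b k :: nat
    by (auto intro: le_less_trans)
  then show ?thesis
    unfolding deriv_coeff_def lessThan_Suc_atMost by (simp add: Bex_def)
qed

lemma diff_monom_single:
  assumes "keys m \<subseteq> {..n}"
  shows "diff_monom n m (single a x) = single (a - m) (of_nat (deriv_coeff n m a) * x)"
proof -
  have "fold (\<lambda>i. pdiff i ^^ lookup m i) [0..<k] (single a x)
    = single (a - (\<Sum>i<k. single i (lookup m i))) (of_nat (\<Prod>i<k. \<Prod>l<lookup m i. lookup a i - l) * x)" for k
  proof (induction k)
    case (Suc k)
    have "lookup (a - (\<Sum>i<k. single i (lookup m i))) k = lookup a k"
      by (simp add: lookup_minus lookup_sum lookup_single when_def)
    moreover have "a - (\<Sum>i<k. single i (lookup m i)) - single k (lookup m k)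
        = a - (\<Sum>i<Suc k. single i (lookup m i))"
      by (rule poly_mapping_eqI) (simp add: lookup_minus lookup_add)
    ultimately show ?case
      by (simp add: Suc.IH pdiff_funpow_single mult_ac)
  qed simp
  moreover have "(\<Sum>i<Suc n. single i (lookup m i)) = m"
    using assms
    by (intro poly_mapping_eqI) (auto simp: lookup_sum lookup_single when_def in_keys_iff less_Suc_eq_le simp del: sum.lessThan_Suc)
  ultimately show ?thesis
    unfolding diff_monom_def deriv_coeff_def by metis
qed

lemma apolar_action_monomial:
  assumes "g \<in> mpols n"
  shows "apolar_action n g (single a 1)
    = (\<Sum>m\<in>keys g. single (a - m) (lookup g m * of_nat (deriv_coeff n m a)))"
  unfolding apolar_action_def using assms
  by (intro sum.cong) (simp_all add: mpols_def diff_monom_single scale_single)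

text \<open>A monomial operator that does not exceed \<open>a\<close> sends the form to a nonzero
  multiple (characteristic 0) of a monomial, different operators giving different monomials; all
  others kill it. So no cancellation can occur and the annihilator is a monomial ideal.\<close>

lemma annihilator_monomial:
  "annihilator n (single a (1 :: 'a::field_char_0))
    = {g \<in> mpols n. \<forall>m\<in>keys g. \<exists>i\<le>n. lookup a i < lookup m i}"
proof (intro equalityI subsetI)
  fix g :: "'a mpol"
  assume "g \<in> annihilator n (single a 1)"
  then have g: "g \<in> mpols n" "apolar_action n g (single a 1) = 0" by (auto simp: annihilator_def)
  have "\<exists>i\<le>n. lookup a i < lookup b i" if b: "b \<in> keys g" for b
  proof (rule ccontr)
    assume nb: "\<not> (\<exists>i\<le>n. lookup a i < lookup b i)"
    \<comment> \<open>\<open>m\<close> is recovered from the truncated difference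
      \<open>a - m\<close>, since it lies below \<open>a\<close> at the indices up to
      \<open>n\<close> and vanishes elsewhere.\<close>
    have "m = b" if m: "m \<in> keys g" "deriv_coeff n m a \<noteq> 0" "a - m = a - b" for m
    proof (rule poly_mapping_eqI)
      fix i
      have eq: "lookup a i - lookup m i = lookup a i - lookup b i"
        using arg_cong[OF m(3), of "\<lambda>m. lookup m i"] by (simp add: lookup_minus)
      show "lookup m i = lookup b i"
      proof (cases "i \<le> n")
        case True
        then have "lookup m i \<le> lookup a i" "lookup b i \<le> lookup a i"
          using m(2) nb by (auto simp: deriv_coeff_eq_0_iff not_less)
        then show ?thesis using eq by simp
      next
        case False
        then have "i \<notin> keys m" "i \<notin> keys b" using g(1) m(1) b by (auto simp: mpols_def)
        then show ?thesis by (simp add: in_keys_iff)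
      qed
    qed
    then have "lookup (\<Sum>m\<in>keys g. single (a - m) (lookup g m * of_nat (deriv_coeff n m a))) (a - b)
      = (\<Sum>m\<in>keys g. if m = b then lookup g b * of_nat (deriv_coeff n b a) else 0)"
      unfolding lookup_sum by (intro sum.cong) (auto simp: lookup_single when_def)
    then have "lookup g b * of_nat (deriv_coeff n b a) = 0"
      using g b by (simp add: apolar_action_monomial)
    then show False using b nb by (auto simp: deriv_coeff_eq_0_iff in_keys_iff)
  qed
  then show "g \<in> {g \<in> mpols n. \<forall>m\<in>keys g. \<exists>i\<le>n. lookup a i < lookup m i}"
    using g by blast
next
  fix g :: "'a mpol"
  assume g: "g \<in> {g \<in> mpols n. \<forall>m\<in>keys g. \<exists>i\<le>n. lookup a i < lookup m i}"
  then have "deriv_coeff n m a = 0" if "m \<in> keys g" for m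
    using that by (auto simp: deriv_coeff_eq_0_iff)
  then show "g \<in> annihilator n (single a 1)"
    using g by (auto simp: annihilator_def apolar_action_monomial intro!: sum.neutral)
qed

text \<open>If \<open>f\<close> contained a monomial \<open>b\<close> not exceeding
  \<open>a\<close>, then \<open>b\<close> would be standard and no other monomial of
  \<open>f\<close> could contribute to the coefficient of \<open>b\<close> in the normal form, which
  is 0.\<close>

lemma binomial_ideal_subset_annihilator:
  fixes c :: "'a::field_char_0"
  assumes c: "c = 0 \<or> (\<forall>i<n. lookup a n \<le> lookup a i)"
    and e: "e = (\<lambda>i. lookup a i + 1)"
  shows "binomial_ideal n e c \<subseteq> annihilator n (single a 1)"
proof
  fix f assume "f \<in> binomial_ideal n e c"
  then have f: "f \<in> mpols n" "nf n e c f = 0" by (auto simp: binomial_ideal_def)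
  have "\<exists>i\<le>n. lookup a i < lookup b i" if b: "b \<in> keys f" for b
  proof (rule ccontr)
    assume nb: "\<not> (\<exists>i\<le>n. lookup a i < lookup b i)"
    have std: "standard n e b"
      unfolding standard_def
    proof (intro conjI allI impI)
      show "keys b \<subseteq> {..n}" using f b by (simp add: mpols_def)
      show "lookup b i < e i" if "i < n" for i
        using nb that by (metis e less_imp_le less_Suc_eq_le not_less Suc_eq_plus1)
    qed
    have 0: "c ^ red_weight n e m = 0" if m: "m \<in> keys f" "m \<noteq> b" "red n e m = b" for m
    proof -
      have w: "red_weight n e m \<noteq> 0"
        using m f red_weight_eq_0D[of n e m] by (auto simp: mpols_def)
      then obtain i where i: "i < n" "lookup m i div e i \<noteq> 0"
        by (auto simp: red_weight_def)
      \<comment> \<open>A rewritten power of \<open>y_i\<close> leaves at least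
        \<open>lookup a i + 1\<close> factors \<open>y_n\<close> in \<open>b\<close>, which has at
        most \<open>lookup a n\<close>. This refutes the second alternative for \<open>c\<close>;
        under the first, a positive power of \<open>c\<close> is 0.\<close>
      have "lookup b n \<ge> (\<Sum>i<n. e i * (lookup m i div e i))"
        using m(3) lookup_red[of n e m n] by simp
      moreover have "(\<Sum>i<n. e i * (lookup m i div e i)) \<ge> e i * (lookup m i div e i)"
        using i by (intro member_le_sum) auto
      moreover have "e i * (lookup m i div e i) \<ge> e i" using i by simp
      moreover have "lookup b n \<le> lookup a n" using nb by (simp add: not_less)
      ultimately have "\<not> lookup a n \<le> lookup a i" by (simp add: e)
      then show ?thesis using c i w by auto
    qed
    have "lookup (nf n e c f) b = (\<Sum>m\<in>keys f. if m = b then lookup f b else 0)"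
      unfolding nf_def lookup_sum using 0 standardD[OF std]
      by (intro sum.cong) (auto simp: lookup_single when_def)
    then show False using f b by (simp add: in_keys_iff)
  qed
  then show "f \<in> annihilator n (single a 1)" using f by (simp add: annihilator_monomial)
qed

section \<open>Smoothness\<close>

lemma eval_ac_add: "eval_ac n (f + g) p = eval_ac n f p + eval_ac n g p"
  unfolding eval_ac_def by (rule sum_keys_add) (simp_all add: distrib_right)

lemma eval_ac_diff: "eval_ac n (f - g) p = eval_ac n f p - eval_ac n g p"
  using eval_ac_add[of n "f - g" g p] by (simp add: algebra_simps)

lemma eval_ac_single: "eval_ac n (single m x) p = to_ac x * (\<Prod>i\<le>n. p i ^ lookup m i)"
  unfolding eval_ac_def by (rule sum_keys_single) simp

lemma eval_ac_single_power: "i \<le> n \<Longrightarrow> eval_ac n (single (single i k) x) p = to_ac x * p i ^ k"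
  by (simp add: eval_ac_single lookup_single when_def if_distrib[of "\<lambda>k. _ ^ k"] cong: if_cong)

lemma eval_ac_0 [simp]: "eval_ac n 0 p = 0"
  by (simp add: eval_ac_def)

lemma eval_ac_pdiff_single_power:
  assumes "i \<le> n"
  shows "(\<Sum>l\<le>n. v l * eval_ac n (pdiff l (single (single i k) x)) p)
    = v i * (of_nat k * to_ac x * p i ^ (k - 1))"
proof -
  have "pdiff l (single (single i k) x) = (if l = i then single (single i (k - 1)) (of_nat k * x) else 0)" for l
    by (simp add: pdiff_single lookup_single when_def single_diff)
  then have "(\<Sum>l\<le>n. v l * eval_ac n (pdiff l (single (single i k) x)) p)
      = (\<Sum>l\<le>n. if l = i then v i * (of_nat k * to_ac x * p i ^ (k - 1)) else 0)"
    using assms by (intro sum.cong) (simp_all add: eval_ac_single_power)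
  then show ?thesis using assms by simp
qed

text \<open>The binomials alone settle the Jacobian criterion: their gradients at \<open>p\<close>
  express each \<open>v i\<close> through \<open>v n\<close>, and the equations of \<open>p\<close>
  turn this into proportionality to \<open>p\<close>.\<close>

lemma smooth_binomial_ideal:
  fixes c :: "'a::field_char_0"
  assumes e: "\<And>i. i < n \<Longrightarrow> 0 < e i" and c: "c \<noteq> 0"
  shows "smooth_finite_subscheme n (binomial_ideal n e c)"
  unfolding smooth_finite_subscheme_def
proof (intro conjI allI impI, rule finite_subscheme_binomial_ideal[OF e])
  fix p v :: "nat \<Rightarrow> 'a alg_closure"
  let ?J = "binomial_ideal n e c"
  let ?b = "\<lambda>i. single (single i (e i)) 1 - single (single n (e i)) c"
  assume p: "(\<exists>i\<le>n. p i \<noteq> 0) \<and> (\<forall>f\<in>?J. eval_ac n f p = 0)"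
    and v: "\<forall>f\<in>?J. (\<Sum>i\<le>n. v i * eval_ac n (pdiff i f) p) = 0"
  have b: "?b i \<in> ?J" if "i < n" for i
    using that e by (intro binomial_in_ideal) auto
  have pi: "p i ^ e i = to_ac c * p n ^ e i" if i: "i < n" for i
  proof -
    have "eval_ac n (?b i) p = 0" using b[OF i] p by blast
    then show ?thesis using i by (simp add: eval_ac_diff eval_ac_single_power)
  qed
  \<comment> \<open>Otherwise all coordinates of \<open>p\<close> would vanish.\<close>
  have pn: "p n \<noteq> 0"
  proof
    assume "p n = 0"
    then have "p i = 0" if "i < n" for i using pi[OF that] e[OF that] by (simp add: power_0_left)
    then show False using p \<open>p n = 0\<close> by (metis le_neq_implies_less)
  qed
  have vi: "v i = v n / p n * p i" if i: "i < n" for i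
  proof -
    obtain k where k: "e i = Suc k" using e[OF i] gr0_implies_Suc by blast
    have "(\<Sum>l\<le>n. v l * eval_ac n (pdiff l (?b i)) p) = 0" using v b[OF i] by blast
    then have "v i * (of_nat (e i) * p i ^ k) = v n * (of_nat (e i) * to_ac c * p n ^ k)"
      using i eval_ac_pdiff_single_power[of i n v "e i" 1 p] eval_ac_pdiff_single_power[of n n v "e i" c p]
      by (simp add: pdiff_diff eval_ac_diff right_diff_distrib sum_subtractf k)
    then have "of_nat (e i) * (v i * p i ^ k) = of_nat (e i) * (v n * to_ac c * p n ^ k)"
      by (simp only: mult_ac)
    \<comment> \<open>Characteristic 0 allows cancelling \<open>e i\<close>.\<close>
    then have "v i * p i ^ k = v n * to_ac c * p n ^ k"
      using k by (simp del: of_nat_Suc)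
    \<comment> \<open>Multiplying by \<open>p i\<close> restores the power that \<open>pi\<close>
      evaluates.\<close>
    then have "v i * p i ^ e i = v n * to_ac c * p n ^ k * p i"
      by (simp add: k mult_ac)
    then have "(to_ac c * p n ^ k) * (v i * p n) = (to_ac c * p n ^ k) * (v n * p i)"
      unfolding pi[OF i] by (simp add: k mult_ac)
    then show ?thesis using c pn by (simp add: field_simps)
  qed
  have "v i = v n / p n * p i" if "i \<le> n" for i
    using vi[of i] pn that by (cases "i = n") auto
  then show "\<exists>a. \<forall>i\<le>n. v i = a * p i" by blast
qed

section \<open>Degeneration\<close>

lemma lookup_map: "\<phi> 0 = 0 \<Longrightarrow> lookup (Poly_Mapping.map \<phi> f) m = \<phi> (lookup f m)"
  by (simp add: map.rep_eq when_def)

lemma map_0: "\<phi> 0 = 0 \<Longrightarrow> Poly_Mapping.map \<phi> 0 = 0"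
  by (rule poly_mapping_eqI) (simp add: lookup_map)

text \<open>Normal forms commute with ring homomorphisms. This is applied to reduction modulo t,
  where \<open>fps_X\<close> becomes 0, and to the embedding of power series into Laurent
  series.\<close>

lemma map_nf:
  fixes \<phi> :: "'a::comm_ring_1 \<Rightarrow> 'b::comm_ring_1"
  assumes "\<phi> 0 = 0" "\<phi> 1 = 1" "\<And>x y. \<phi> (x + y) = \<phi> x + \<phi> y" "\<And>x y. \<phi> (x * y) = \<phi> x * \<phi> y"
  shows "Poly_Mapping.map \<phi> (nf n e c f) = nf n e (\<phi> c) (Poly_Mapping.map \<phi> f)"
proof -
  have add: "Poly_Mapping.map \<phi> (g + h) = Poly_Mapping.map \<phi> g + Poly_Mapping.map \<phi> h" for g h :: "'a mpol"
    by (rule poly_mapping_eqI) (simp add: lookup_map lookup_add assms)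
  have pow: "\<phi> (x ^ k) = \<phi> x ^ k" for x k
    by (induction k) (simp_all add: assms)
  show ?thesis
    by (induction f rule: mpol_induct) (simp_all add: nf_add add nf_single assms pow map_0)
qed

lemma keys_map_subset: "\<phi> 0 = 0 \<Longrightarrow> keys (Poly_Mapping.map \<phi> f) \<subseteq> keys f"
  by (auto simp: in_keys_iff lookup_map)

lemma map_in_mpols: "\<phi> 0 = 0 \<Longrightarrow> f \<in> mpols n \<Longrightarrow> Poly_Mapping.map \<phi> f \<in> mpols n"
  using keys_map_subset[of \<phi> f] by (auto simp: mpols_def)

lemma flat_limit_binomial_ideal:
  assumes e: "\<And>i. i < n \<Longrightarrow> 0 < e i"
  shows "flat_limit n (binomial_ideal n e fls_X) = binomial_ideal n e (0 :: 'a::field)"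
proof -
  let ?r = "Poly_Mapping.map (\<lambda>s. fps_nth s 0) :: 'a fps mpol \<Rightarrow> 'a mpol"
  let ?i = "Poly_Mapping.map fps_to_fls :: 'a fps mpol \<Rightarrow> 'a fls mpol"
  have r: "?r (nf n e fps_X f) = nf n e 0 (?r f)" for f
    using map_nf[of "\<lambda>s. fps_nth s 0" n e fps_X f] by simp
  have i: "?i (nf n e fps_X f) = nf n e fls_X (?i f)" for f
    using map_nf[of fps_to_fls n e fps_X f] by (simp add: fls_times_fps_to_fls)
  have i0: "?i f = 0 \<longleftrightarrow> f = 0" for f
    by (auto simp: poly_mapping_eq_iff fun_eq_iff lookup_map)
  have "{?r f | f. f \<in> mpols n \<and> ?i f \<in> binomial_ideal n e fls_X} = binomial_ideal n e 0"
  proof (intro equalityI subsetI)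
    fix g assume "g \<in> {?r f | f. f \<in> mpols n \<and> ?i f \<in> binomial_ideal n e fls_X}"
    then obtain f where f: "g = ?r f" "f \<in> mpols n" "?i f \<in> binomial_ideal n e fls_X" by blast
    then have "nf n e fps_X f = 0" using i[of f] i0 by (simp add: binomial_ideal_def)
    then have "nf n e 0 g = 0" using r[of f] f by (simp add: map_0)
    then show "g \<in> binomial_ideal n e 0" using f by (simp add: binomial_ideal_def map_in_mpols)
  next
    fix g assume g: "g \<in> binomial_ideal n e (0 :: 'a)"
    \<comment> \<open>To lift \<open>g\<close> into the family, take its constant lift and subtract
      the normal form over power series. That correction reduces to \<open>nf n e 0 g = 0\<close>
      modulo t.\<close>
    define h where "h = Poly_Mapping.map fps_const g"
    define f where "f = h - nf n e fps_X h"
    have "h \<in> mpols n" using g by (simp add: h_def binomial_ideal_def map_in_mpols)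
    then have f: "f \<in> mpols n"
      unfolding f_def using nf_in_mpols[of n e fps_X h] keys_diff[of h "nf n e fps_X h"]
      by (auto simp: mpols_def)
    have rh: "?r h = g" by (rule poly_mapping_eqI) (simp add: h_def lookup_map)
    then have "?r (nf n e fps_X h) = 0" using r[of h] g by (simp add: binomial_ideal_def)
    then have "?r f = g"
      by (intro poly_mapping_eqI) (metis (no_types, lifting) f_def rh diff_zero fps_sub_nth fps_zero_nth lookup_map lookup_minus lookup_zero)
    moreover have "nf n e fls_X (?i f) = 0"
      using i[of f] by (simp add: f_def nf_diff nf_nf map_0)
    ultimately show "g \<in> {?r f | f. f \<in> mpols n \<and> ?i f \<in> binomial_ideal n e fls_X}"
      using f by (auto simp: binomial_ideal_def map_in_mpols)
  qed
  moreover have "saturation n (binomial_ideal n e 0) = binomial_ideal n e (0 :: 'a)"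
    using closed_subscheme_binomial_ideal[of n e "0 :: 'a"] e by (simp add: closed_subscheme_def)
  ultimately show ?thesis by (simp add: flat_limit_def)
qed

lemma smoothable_binomial_ideal:
  assumes "\<And>i. i < n \<Longrightarrow> 0 < e i"
  shows "smoothable n (binomial_ideal n e (0 :: 'a::field_char_0))"
  unfolding smoothable_def
  using flat_limit_binomial_ideal[of n e] smooth_binomial_ideal[of n e "fls_X :: 'a fls"] assms
  by (intro exI[of _ "binomial_ideal n e fls_X"]) simp

section \<open>The lower bound\<close>

lemma closed_subschemeD:
  assumes "closed_subscheme n I"
  shows "ideal I (mpol_ring n)"
    and "\<And>f. f \<in> mpols n \<Longrightarrow> (\<And>i. i \<le> n \<Longrightarrow> \<exists>k. var i ^ k * f \<in> I) \<Longrightarrow> f \<in> I"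
proof -
  show "ideal I (mpol_ring n)"
    using assms by (simp add: closed_subscheme_def homogeneous_ideal_def)
  fix f assume "f \<in> mpols n" "\<And>i. i \<le> n \<Longrightarrow> \<exists>k. var i ^ k * f \<in> I"
  then have "f \<in> saturation n I" by (simp add: saturation_def)
  then show "f \<in> I" using assms by (simp add: closed_subscheme_def)
qed

lemma mpols_power:
  fixes q :: "'a::comm_ring_1 mpol"
  shows "q \<in> mpols n \<Longrightarrow> q ^ N \<in> mpols n"
  by (induction N) (simp_all add: mpols_mult, simp add: mpols_def)

lemma mpols_scale: "f \<in> mpols n \<Longrightarrow> scale c f \<in> mpols n"
  using keys_scale[of c f] by (auto simp: mpols_def)

lemma var_power_in_mpols: "i \<le> n \<Longrightarrow> (var i ^ k :: 'a::comm_ring_1 mpol) \<in> mpols n"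
  using var_power_in_graded_part graded_part_subset_mpols by blast

lemma ideal_scale:
  assumes "ideal I (mpol_ring n)" "f \<in> I"
  shows "scale c f \<in> I"
  unfolding scale_def by (rule ideal_mpol_ringD(4)[OF assms(1) single_in_mpols assms(2)]) simp

lemma ideal_diff:
  fixes f g :: "'a::comm_ring_1 mpol"
  assumes "ideal I (mpol_ring n)" "f \<in> I" "g \<in> I"
  shows "f - g \<in> I"
proof -
  have "f + scale (- 1) g \<in> I"
    using assms by (intro ideal_mpol_ringD(3)[OF assms(1)] ideal_scale)
  moreover have "scale (- 1) g = - g"
    by (rule poly_mapping_eqI) (simp add: lookup_scale)
  ultimately show ?thesis by simp
qed

section \<open>Generic nonzerodivisors modulo a saturated ideal\<close>

lemma card_le_hilbert_function:
  assumes "ideal I (mpol_ring n)" "indep_over scale (graded_part n k \<inter> I) T x"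
    and "x ` T \<subseteq> graded_part n k"
  shows "card T \<le> hilbert_function n I k"
  using mpol.indep_over_card_le[OF subspace_Int_ideal[OF assms(1)] _ graded_part_finite_span _ assms(2,3)]
  unfolding hilbert_function_def by (simp add: finite_monomials)

text \<open>Raises the degree of an element that no power of \<open>q\<close> kills modulo
  \<open>I\<close>. Some \<open>var i\<close> preserves this property: otherwise one power of
  \<open>q\<close> would kill all products with variables, and by saturation the element
  itself.\<close>

lemma torsion_free_shift:
  fixes q x :: "'a::comm_ring_1 mpol"
  assumes I: "closed_subscheme n I" and q: "q \<in> mpols n" and x: "x \<in> graded_part n k"
    and nz: "\<And>N. q ^ N * x \<notin> I" and "k \<le> K"
  shows "\<exists>m\<in>mpols n. m * x \<in> graded_part n K \<and> (\<forall>N. q ^ N * (m * x) \<notin> I)"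
  using \<open>k \<le> K\<close>
proof (induction K rule: dec_induct)
  case base
  show ?case
    using x nz by (intro bexI[of _ 1]) (auto simp: mpols_def)
next
  case (step K)
  then obtain m where m: "m \<in> mpols n" "m * x \<in> graded_part n K" "\<And>N. q ^ N * (m * x) \<notin> I"
    by blast
  have "\<exists>i\<le>n. \<forall>N. q ^ N * (var i * (m * x)) \<notin> I"
  proof (rule ccontr)
    assume "\<not> (\<exists>i\<le>n. \<forall>N. q ^ N * (var i * (m * x)) \<notin> I)"
    then obtain N where N: "\<And>i. i \<le> n \<Longrightarrow> q ^ N i * (var i * (m * x)) \<in> I" by metis
    \<comment> \<open>A common bound for the exponents \<open>N i\<close>.\<close>
    define M where "M = (\<Sum>i\<le>n. N i)"
    have "q ^ M * (m * x) \<in> I"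
    proof (rule closed_subschemeD(2)[OF I])
      show "q ^ M * (m * x) \<in> mpols n"
        by (rule mpols_mult[OF mpols_power[OF q] subsetD[OF graded_part_subset_mpols m(2)]])
      fix i assume i: "i \<le> n"
      then have "N i \<le> M" unfolding M_def by (intro member_le_sum) auto
      then have "q ^ M = q ^ (M - N i) * q ^ N i" by (simp flip: power_add)
      then have "var i ^ 1 * (q ^ M * (m * x)) = q ^ (M - N i) * (q ^ N i * (var i * (m * x)))"
        by (simp add: mult_ac)
      also have "\<dots> \<in> I"
        by (rule ideal_mpol_ringD(4)[OF closed_subschemeD(1)[OF I] mpols_power[OF q] N[OF i]])
      finally show "\<exists>k. var i ^ k * (q ^ M * (m * x)) \<in> I" by blast
    qed
    then show False using m by blast
  qed
  then obtain i where i: "i \<le> n" "\<And>N. q ^ N * (var i * (m * x)) \<notin> I" by blast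
  have "var i * (m * x) \<in> graded_part n (1 + K)"
    using i m var_power_in_graded_part[of i n 1] by (intro graded_part_mult) simp_all
  moreover have "var i * m \<in> mpols n"
    using i m var_power_in_mpols[of i n 1] by (intro mpols_mult) simp_all
  ultimately show ?case
    using i by (intro bexI[of _ "var i * m"]) (simp_all add: mult.assoc)
qed

text \<open>
  Modulo \<open>I\<close>, the \<open>x t\<close> behave like eigenvectors of \<open>- p / q\<close> for the distinct eigenvalues \<open>t\<close>.
\<close>

lemma pencil_indep:
  fixes p q :: "'a::field mpol"
  assumes I: "ideal I (mpol_ring n)" and p: "p \<in> mpols n" and q: "q \<in> mpols n" and "finite T"
    and x: "\<And>t. t \<in> T \<Longrightarrow> (p + scale t q) * x t \<in> I"
    and xm: "\<And>t. t \<in> T \<Longrightarrow> x t \<in> mpols n"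
    and nz: "\<And>t N. t \<in> T \<Longrightarrow> q ^ N * x t \<notin> I"
    and "q ^ N * (\<Sum>t\<in>T. scale (u t) (x t)) \<in> I" "t \<in> T"
  shows "u t = 0"
  using \<open>finite T\<close> x xm nz assms(8,9)
proof (induction T arbitrary: N u t rule: finite_induct)
  case (insert s T)
  note idD = ideal_mpol_ringD[OF I]
  let ?S = "\<Sum>t\<in>T. scale (u t) (x t)"
  \<comment> \<open>Multiplication by \<open>p + scale s q\<close> kills \<open>x s\<close> modulo
    \<open>I\<close> and acts on \<open>x t\<close> as \<open>(s - t) q\<close>. So
    \<open>?Q\<close> is a shorter relation with one more factor \<open>q\<close>, which is why
    \<open>N\<close> varies in the induction.\<close>
  let ?Q = "\<Sum>t\<in>T. scale (u t * (s - t)) (x t)"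
  have sq: "scale s q \<in> mpols n" using q by (rule mpols_scale)
  have xI: "scale c ((p + scale t q) * x t) \<in> I" if "t \<in> insert s T" for c t
    using insert.prems(1)[OF that] by (rule ideal_scale[OF I])
  have "(\<Sum>t\<in>T. scale (u t) ((p + scale t q) * x t)) \<in> I"
  proof -
    have "(\<Sum>t\<in>A. scale (u t) ((p + scale t q) * x t)) \<in> I" if "finite A" "A \<subseteq> T" for A
      using that xI by (induction A rule: finite_induct) (simp_all add: idD(2,3))
    then show ?thesis using insert.hyps by blast
  qed
  then have A: "q ^ N * ((\<Sum>t\<in>T. scale (u t) ((p + scale t q) * x t))
      + scale (u s) ((p + scale s q) * x s)) \<in> I"
    using xI by (intro idD(4) idD(3) mpols_power q) simp_all
  have X: "(p + scale s q) * (q ^ N * (?S + scale (u s) (x s))) \<in> I"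
  proof (rule idD(4))
    show "p + scale s q \<in> mpols n" using p sq by (rule mpols_add)
    show "q ^ N * (?S + scale (u s) (x s)) \<in> I"
      using insert.prems(4) insert.hyps by (simp add: add.commute)
  qed
  have eq: "(p + scale s q) * (q ^ N * (?S + scale (u s) (x s)))
      = q ^ N * ((\<Sum>t\<in>T. scale (u t) ((p + scale t q) * x t))
        + scale (u s) ((p + scale s q) * x s)) + q ^ Suc N * ?Q"
  proof -
    have c: "(p + scale s q) * scale (u t) (x t)
        = scale (u t) ((p + scale t q) * x t) + q * scale (u t * (s - t)) (x t)" for t
    proof -
      have 0: "single 0 (u t * (s - t)) = single 0 (u t) * (single 0 s - single 0 t)"
        by (simp add: mult_single flip: single_diff)
      show ?thesis unfolding scale_def 0 by (simp add: algebra_simps)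
    qed
    have "(p + scale s q) * ?S = (\<Sum>t\<in>T. scale (u t) ((p + scale t q) * x t)) + q * ?Q"
      unfolding sum_distrib_left c sum.distrib ..
    moreover have "(p + scale s q) * scale (u s) (x s) = scale (u s) ((p + scale s q) * x s)"
      by (rule scale_mult_right)
    moreover have "(p + scale s q) * (q ^ N * (?S + scale (u s) (x s)))
        = q ^ N * ((p + scale s q) * ?S + (p + scale s q) * scale (u s) (x s))"
      by (simp only: mult.left_commute[of _ "q ^ N"] distrib_left)
    moreover have "q ^ N * (a + q * b + c) = q ^ N * (a + c) + q ^ Suc N * b" for a b c :: "'a mpol"
      by (simp add: algebra_simps)
    ultimately show ?thesis by (simp only:)
  qed
  have "q ^ Suc N * ?Q \<in> I"
    using ideal_diff[OF I X A] unfolding eq add_diff_cancel_left' .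
  then have "u t * (s - t) = 0" if "t \<in> T" for t
    by (rule insert.IH[where u = "\<lambda>t. u t * (s - t)" and N = "Suc N", rotated 3])
      (simp_all add: insert.prems(1-3) that)
  \<comment> \<open>\<open>s - t\<close> is nonzero because \<open>s \<notin> T\<close>.\<close>
  then have 0: "u t = 0" if "t \<in> T" for t
    using that insert.hyps by force
  then have "q ^ N * scale (u s) (x s) \<in> I"
    using insert.prems(4) insert.hyps by simp
  then have "scale (inverse (u s)) (q ^ N * scale (u s) (x s)) \<in> I"
    by (rule ideal_scale[OF I])
  moreover have "scale (inverse (u s)) (q ^ N * scale (u s) (x s)) = q ^ N * x s" if "u s \<noteq> 0"
    using that by (simp add: scale_mult_right)
  ultimately have "u s = 0" using insert.prems(3)[of s N] by (metis insertI1)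
  then show ?case using 0 insert.prems(5) by blast
qed simp

text \<open>If every \<open>t\<close> had a counterexample \<open>x t\<close>, then
  \<open>r + 1\<close> of them, moved to a common large degree, would be independent modulo
  \<open>I\<close> by \<open>pencil_indep\<close>, exceeding the bound on the Hilbert
  function.\<close>

lemma generic_pencil:
  fixes p q :: "'a::field_char_0 mpol"
  assumes I: "closed_subscheme n I" and H: "\<And>k. k \<ge> k0 \<Longrightarrow> hilbert_function n I k \<le> r"
    and p: "p \<in> mpols n" and q: "q \<in> mpols n"
  shows "\<exists>t. \<forall>k. \<forall>x\<in>graded_part n k. (p + scale t q) * x \<in> I \<longrightarrow>
    (\<exists>N. p ^ N * x \<in> I) \<and> (\<exists>N. q ^ N * x \<in> I)"
proof (rule ccontr)
  assume "\<not> ?thesis"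
  then obtain k x where x: "\<And>t. x t \<in> graded_part n (k t)" "\<And>t. (p + scale t q) * x t \<in> I"
    and ntor: "\<And>t. \<not> ((\<exists>N. p ^ N * x t \<in> I) \<and> (\<exists>N. q ^ N * x t \<in> I))"
    by metis
  note id = closed_subschemeD(1)[OF I]
  note idD = ideal_mpol_ringD[OF id]
  have nz: "q ^ N * x t \<notin> I" for t N
  proof
    assume N: "q ^ N * x t \<in> I"
    have "p ^ j * x t - scale ((- t) ^ j) (q ^ j * x t) \<in> I" for j
    proof (induction j)
      case 0
      show ?case using idD(2) by simp
    next
      case (Suc j)
      have "single 0 ((- t) ^ Suc j) = - (single 0 t * single 0 ((- t) ^ j) :: 'a mpol)"
        by (simp add: mult_single single_uminus)
      then have "p ^ Suc j * x t - scale ((- t) ^ Suc j) (q ^ Suc j * x t)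
        = p * (p ^ j * x t - scale ((- t) ^ j) (q ^ j * x t))
          + scale ((- t) ^ j) (q ^ j * ((p + scale t q) * x t))"
        unfolding scale_def by (simp add: algebra_simps)
      also have "\<dots> \<in> I"
        by (rule idD(3)[OF idD(4)[OF p Suc.IH] ideal_scale[OF id idD(4)[OF mpols_power[OF q] x(2)]]])
      finally show ?case .
    qed
    from this[of N] have "p ^ N * x t \<in> I"
      using idD(3)[OF _ ideal_scale[OF id N]] by (metis diff_add_cancel)
    then show False using N ntor by blast
  qed
  obtain T :: "'a set" where T: "finite T" "card T = Suc r"
    using infinite_arbitrarily_large[OF infinite_UNIV_char_0] by blast
  \<comment> \<open>A degree at least \<open>k0\<close> and at least every
    \<open>k t\<close>.\<close>
  define K where "K = k0 + (\<Sum>t\<in>T. k t)"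
  have "\<exists>m\<in>mpols n. m * x t \<in> graded_part n K \<and> (\<forall>N. q ^ N * (m * x t) \<notin> I)" if "t \<in> T" for t
  proof (rule torsion_free_shift[OF I q x(1) nz])
    show "k t \<le> K" using T that member_le_sum[of t T k] by (simp add: K_def)
  qed
  then obtain m where m: "\<And>t. t \<in> T \<Longrightarrow> m t \<in> mpols n"
      "\<And>t. t \<in> T \<Longrightarrow> m t * x t \<in> graded_part n K"
      "\<And>t N. t \<in> T \<Longrightarrow> q ^ N * (m t * x t) \<notin> I"
    by metis
  have "u t = 0" if "(\<Sum>t\<in>T. scale (u t) (m t * x t)) \<in> I" "t \<in> T" for u t
  proof (rule pencil_indep[OF id p q T(1), where N = 0 and x = "\<lambda>t. m t * x t" and u = u])
    fix t assume t: "t \<in> T"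
    have "m t * ((p + scale t q) * x t) \<in> I"
      by (rule idD(4)[OF m(1)[OF t] x(2)])
    then show "(p + scale t q) * (m t * x t) \<in> I" by (simp add: mult.left_commute)
    show "m t * x t \<in> mpols n" using m t graded_part_subset_mpols by blast
    show "q ^ N * (m t * x t) \<notin> I" for N using m t by blast
  qed (use that in simp_all)
  then have "indep_over scale (graded_part n K \<inter> I) T (\<lambda>t. m t * x t)"
    using T by (auto simp: indep_over_def)
  then have "card T \<le> hilbert_function n I K"
    using m by (intro card_le_hilbert_function[OF id]) auto
  also have "\<dots> \<le> r" using H by (simp add: K_def)
  finally show False using T by simp
qed

text \<open>Induction on the number of variables: \<open>generic_pencil\<close> joins the
  combination found so far with the next power \<open>var (Suc m) ^ \<delta>\<close>.\<close>

lemma generic_power_combination: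
  fixes I :: "'a::field_char_0 mpol set"
  assumes I: "closed_subscheme n I" and H: "\<And>k. k \<ge> k0 \<Longrightarrow> hilbert_function n I k \<le> r"
    and "m \<le> n"
  shows "\<exists>t. \<forall>k. \<forall>x\<in>graded_part n k. (\<Sum>i\<le>m. scale (t i) (var i ^ \<delta>)) * x \<in> I \<longrightarrow>
    (\<forall>i\<le>m. \<exists>N. var i ^ N * x \<in> I)"
  using \<open>m \<le> n\<close>
proof (induction m)
  case 0
  show ?case by (intro exI[of _ "\<lambda>_. 1"]) auto
next
  case (Suc m)
  obtain t where "\<forall>k. \<forall>x\<in>graded_part n k. (\<Sum>i\<le>m. scale (t i) (var i ^ \<delta>)) * x \<in> I \<longrightarrow>
    (\<forall>i\<le>m. \<exists>N. var i ^ N * x \<in> I)"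
    using Suc.IH[OF Suc_leD[OF Suc.prems]] by (rule exE)
  then have t: "\<exists>N. var i ^ N * x \<in> I"
    if "x \<in> graded_part n k" "(\<Sum>i\<le>m. scale (t i) (var i ^ \<delta>)) * x \<in> I" "i \<le> m" for k x i
    using that by blast
  note id = closed_subschemeD(1)[OF I]
  note idD = ideal_mpol_ringD[OF id]
  let ?p = "\<Sum>i\<le>m. scale (t i) (var i ^ \<delta>)" and ?q = "var (Suc m) ^ \<delta> :: 'a mpol"
  have p: "?p \<in> graded_part n \<delta>"
    using Suc.prems by (intro graded_part_sum graded_part_scale var_power_in_graded_part) auto
  \<comment> \<open>The induction hypothesis speaks of one factor \<open>?p\<close>; peeling factors
    off one by one extends it to powers of \<open>?p\<close>.\<close>
  have pN: "\<exists>N. var i ^ N * x \<in> I" if "?p ^ N * x \<in> I" "x \<in> graded_part n k" "i \<le> m" for N x k i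
    using that
  proof (induction N arbitrary: x k)
    case 0
    then show ?case by (intro exI[of _ 0]) simp
  next
    case (Suc N)
    have "?p * x \<in> graded_part n (\<delta> + k)" using p Suc.prems by (intro graded_part_mult)
    moreover have "?p ^ N * (?p * x) \<in> I" using Suc.prems by (simp add: mult_ac)
    ultimately obtain N1 where "var i ^ N1 * (?p * x) \<in> I" using Suc.IH Suc.prems by blast
    then have "?p * (var i ^ N1 * x) \<in> I" by (simp add: mult_ac)
    moreover have "var i ^ N1 * x \<in> graded_part n (N1 + k)"
      using Suc.prems \<open>Suc m \<le> n\<close> by (intro graded_part_mult var_power_in_graded_part) auto
    ultimately obtain N2 where "var i ^ N2 * (var i ^ N1 * x) \<in> I" using t Suc.prems by blast
    then show ?case by (intro exI[of _ "N2 + N1"]) (simp add: power_add mult.assoc)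
  qed
  have "?p \<in> mpols n" "?q \<in> mpols n"
    using p graded_part_subset_mpols var_power_in_mpols Suc.prems by blast+
  from generic_pencil[OF I H this]
  obtain s where s: "\<And>k x. x \<in> graded_part n k \<Longrightarrow> (?p + scale s ?q) * x \<in> I \<Longrightarrow>
    (\<exists>N. ?p ^ N * x \<in> I) \<and> (\<exists>N. ?q ^ N * x \<in> I)" by blast
  have eq: "(\<Sum>i\<le>Suc m. scale ((t(Suc m := s)) i) (var i ^ \<delta>)) = ?p + scale s ?q"
    by simp
  show ?case
  proof (intro exI[of _ "t(Suc m := s)"] allI ballI impI)
    fix k x i
    assume x: "x \<in> graded_part n k" "(\<Sum>i\<le>Suc m. scale ((t(Suc m := s)) i) (var i ^ \<delta>)) * x \<in> I"
      and i: "i \<le> Suc m"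
    obtain N1 N2 where N: "?p ^ N1 * x \<in> I" "?q ^ N2 * x \<in> I"
      using s[OF x(1)] x(2) unfolding eq by blast
    show "\<exists>N. var i ^ N * x \<in> I"
    proof (cases "i = Suc m")
      case True
      then show ?thesis using N(2) by (auto simp flip: power_mult)
    next
      case False
      then show ?thesis using pN[OF N(1) x(1)] i by simp
    qed
  qed
qed

text \<open>An element killed by the combination is killed by a power of every variable, hence lies
  in the saturation, which is \<open>I\<close>.\<close>

lemma generic_nonzerodivisor:
  fixes I :: "'a::field_char_0 mpol set"
  assumes I: "closed_subscheme n I" and H: "\<And>k. k \<ge> k0 \<Longrightarrow> hilbert_function n I k \<le> r"
  shows "\<exists>t. \<forall>k. \<forall>x\<in>graded_part n k. (\<Sum>i\<le>n. scale (t i) (var i ^ \<delta>)) * x \<in> I \<longrightarrow> x \<in> I"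
proof -
  obtain t where t: "\<forall>k. \<forall>x\<in>graded_part n k. (\<Sum>i\<le>n. scale (t i) (var i ^ \<delta>)) * x \<in> I \<longrightarrow>
    (\<forall>i\<le>n. \<exists>N. var i ^ N * x \<in> I)"
    using generic_power_combination[OF I H order_refl] by blast
  then show ?thesis
    using closed_subschemeD(2)[OF I] graded_part_subset_mpols by (intro exI[of _ t]) blast
qed

section \<open>Comparing Hilbert functions in degrees that differ by \<open>\<delta>\<close>\<close>

text \<open>In characteristic 0, the monomial basis in degree \<open>k\<close> of the quotient by
  the annihilator of the monomial with exponents \<open>a\<close>.\<close>

definition box :: "nat \<Rightarrow> (nat \<Rightarrow>\<^sub>0 nat) \<Rightarrow> nat \<Rightarrow> (nat \<Rightarrow>\<^sub>0 nat) set" where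
  "box n a k = {m \<in> monomials n k. \<forall>i\<le>n. lookup m i \<le> lookup a i}"

lemma finite_box: "finite (box n a k)"
  using finite_monomials by (simp add: box_def)

text \<open>Every exponent vector bounded by \<open>a\<close> has degree below \<open>N\<close>, so
  it is counted on the right.\<close>

lemma prod_le_sum_card_box:
  assumes "(\<Sum>i\<le>n. lookup a i) < N"
  shows "(\<Prod>i\<le>n. lookup a i + 1) \<le> (\<Sum>k<N. card (box n a k))"
proof -
  define g where "g h = (\<Sum>i\<le>n. single i (h i))" for h :: "nat \<Rightarrow> nat"
  have lg: "lookup (g h) i = (if i \<le> n then h i else 0)" for h i
    unfolding g_def lookup_sum lookup_single when_def by (simp add: sum.delta')
  let ?P = "PiE {..n} (\<lambda>i. {..lookup a i})"
  have "inj_on g ?P"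
  proof (rule inj_onI)
    fix x y assume xy: "x \<in> ?P" "y \<in> ?P" and eq: "g x = g y"
    have "x i = y i" if "i \<le> n" for i
      using arg_cong[OF eq, of "\<lambda>m. lookup m i"] that by (simp add: lg)
    then show "x = y" using PiE_ext[OF xy] by simp
  qed
  moreover have "g ` ?P \<subseteq> (\<Union>k<N. box n a k)"
  proof (intro image_subsetI)
    fix h assume h: "h \<in> ?P"
    have "mdeg (g h) = (\<Sum>i\<le>n. h i)" by (simp add: g_def mdeg_sum)
    also have "\<dots> \<le> (\<Sum>i\<le>n. lookup a i)" using h by (intro sum_mono) (auto simp: PiE_iff)
    finally have "mdeg (g h) < N" using assms by simp
    moreover have "g h \<in> box n a (mdeg (g h))"
      using h by (auto simp: box_def monomials_def in_keys_iff lg PiE_iff split: if_splits)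
    ultimately show "g h \<in> (\<Union>k<N. box n a k)" by blast
  qed
  ultimately have "card ?P \<le> card (\<Union>k<N. box n a k)"
    by (rule card_inj_on_le) (simp add: finite_box)
  also have "\<dots> \<le> (\<Sum>k<N. card (box n a k))" by (rule card_UN_le) simp
  finally show ?thesis by (simp add: card_PiE)
qed

text \<open>
  If \<open>T\<close> is a basis of a complement of \<open>I\<close> in degree \<open>k\<close>, then \<open>g T\<close> together with the monomials of
  the box is independent modulo \<open>I\<close>, since no monomial of the box occurs in \<open>I\<close> or in a multiple of \<open>g\<close>.
\<close>

lemma card_box_le_hilbert_function:
  fixes I :: "'a::field_char_0 mpol set"
  assumes id: "ideal I (mpol_ring n)" and ann: "I \<subseteq> annihilator n (single a 1)"
    and a: "\<And>i. i \<le> n \<Longrightarrow> lookup a i < \<delta>"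
    and g: "g = (\<Sum>i\<le>n. scale (t i) (var i ^ \<delta>))"
    and nzd: "\<And>k x. x \<in> graded_part n k \<Longrightarrow> g * x \<in> I \<Longrightarrow> x \<in> I"
  shows "card (box n a (k + \<delta>)) + hilbert_function n I k \<le> hilbert_function n I (k + \<delta>)"
    and "card (box n a k) \<le> hilbert_function n I k"
proof -
  have coeff_I: "lookup f b = 0" if "f \<in> I" "b \<in> box n a j" for f b j
  proof (rule ccontr)
    assume "lookup f b \<noteq> 0"
    then have "b \<in> keys f" by (simp add: in_keys_iff)
    then show False using that ann by (force simp: annihilator_monomial box_def)
  qed
  have gk: "\<exists>i\<le>n. m = single i \<delta>" if "m \<in> keys g" for m
  proof -
    have "m \<in> (\<Union>i\<in>{..n}. keys (scale (t i) (var i ^ \<delta>)))"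
      using that unfolding g by (rule subsetD[OF Poly_Mapping.keys_sum])
    then obtain i where "i \<le> n" "m \<in> keys (scale (t i) (var i ^ \<delta>))" by blast
    then show ?thesis using keys_scale[of "t i" "var i ^ \<delta>"] by (auto simp: var_power)
  qed
  \<comment> \<open>Monomials of a multiple of \<open>g\<close> are divisible by some
    \<open>var i ^ \<delta>\<close>, while box exponents stay below \<open>\<delta>\<close>.\<close>
  have coeff_g: "lookup (g * y) b = 0" if "b \<in> box n a j" for y b j
  proof (rule ccontr)
    assume "lookup (g * y) b \<noteq> 0"
    then have "b \<in> keys (g * y)" by (simp add: in_keys_iff)
    then obtain i m where "i \<le> n" "b = single i \<delta> + m" using keys_mult[of g y] gk by blast
    then have "\<delta> \<le> lookup b i" by (simp add: lookup_add)
    then show False using that a[OF \<open>i \<le> n\<close>] \<open>i \<le> n\<close> by (fastforce simp: box_def)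
  qed
  have coeff_box: "lookup (\<Sum>m\<in>box n a j. scale (u m) (single m 1)) b = u b" if "b \<in> box n a j" for u j b
    using lookup_sum_scale_single[OF finite_box _ that, of "\<lambda>m. m" u] by simp
  show "card (box n a k) \<le> hilbert_function n I k"
  proof (rule card_le_hilbert_function[OF id])
    show "indep_over scale (graded_part n k \<inter> I) (box n a k) (\<lambda>m. single m (1::'a))"
      unfolding indep_over_def
    proof (intro conjI allI impI ballI finite_box)
      fix u b
      assume "(\<Sum>m\<in>box n a k. scale (u m) (single m 1)) \<in> graded_part n k \<inter> I" "b \<in> box n a k"
      then show "u b = 0" using coeff_I coeff_box[of b k u] by simp
    qed
    show "(\<lambda>m. single m (1::'a)) ` box n a k \<subseteq> graded_part n k"
      by (auto simp: box_def single_in_graded_part)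
  qed
  have g_gr: "g \<in> graded_part n \<delta>"
    unfolding g by (intro graded_part_sum graded_part_scale var_power_in_graded_part) auto
  obtain T where T: "T \<subseteq> graded_part n k" "indep_over scale (graded_part n k \<inter> I) T (\<lambda>t. t)"
      "card T + mpol.dim (graded_part n k \<inter> I) = mpol.dim (graded_part n k :: 'a mpol set)"
    using mpol.indep_over_exists[OF subspace_Int_ideal[OF id] _ graded_part_finite_span]
    by (metis Int_lower1 finite_imageI finite_monomials)
  have fT: "finite T" using T(2) by (simp add: indep_over_def)
  \<comment> \<open>The disjoint sum indexes both families at once, so that its cardinality is the
    sum of theirs.\<close>
  define x where "x = case_sum (\<lambda>t. g * t) (\<lambda>m. single m (1::'a))"
  have ind: "indep_over scale (graded_part n (k + \<delta>) \<inter> I) (T <+> box n a (k + \<delta>)) x"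
    unfolding indep_over_def
  proof (intro conjI allI impI)
    show "finite (T <+> box n a (k + \<delta>))" using fT finite_box by simp
    fix u assume "(\<Sum>s\<in>T <+> box n a (k + \<delta>). scale (u s) (x s)) \<in> graded_part n (k + \<delta>) \<inter> I"
    moreover have eq: "(\<Sum>s\<in>T <+> box n a (k + \<delta>). scale (u s) (x s))
      = g * (\<Sum>s\<in>T. scale (u (Inl s)) s) + (\<Sum>m\<in>box n a (k + \<delta>). scale (u (Inr m)) (single m 1))"
      by (simp add: sum.Plus[OF fT finite_box] x_def sum_distrib_left scale_mult_right)
    ultimately have I: "g * (\<Sum>s\<in>T. scale (u (Inl s)) s)
      + (\<Sum>m\<in>box n a (k + \<delta>). scale (u (Inr m)) (single m 1)) \<in> I" by simp
    \<comment> \<open>Coefficients at box monomials isolate the second family; what remains is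
      \<open>g\<close> times a combination of \<open>T\<close>, from which \<open>nzd\<close>
      removes \<open>g\<close>.\<close>
    have r: "u (Inr b) = 0" if b: "b \<in> box n a (k + \<delta>)" for b
      using coeff_I[OF I b] coeff_g[OF b] coeff_box[OF b, of "\<lambda>m. u (Inr m)"]
      by (simp add: lookup_add)
    then have "g * (\<Sum>s\<in>T. scale (u (Inl s)) s) \<in> I" using I by simp
    moreover have gr: "(\<Sum>s\<in>T. scale (u (Inl s)) s) \<in> graded_part n k"
      using T(1) by (intro graded_part_sum graded_part_scale) auto
    ultimately have "(\<Sum>s\<in>T. scale (u (Inl s)) s) \<in> graded_part n k \<inter> I" using nzd by blast
    then have "u (Inl s) = 0" if "s \<in> T" for s
      using T(2) that unfolding indep_over_def by (elim conjE allE[of _ "\<lambda>s. u (Inl s)"]) simp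
    then show "\<forall>s\<in>T <+> box n a (k + \<delta>). u s = 0" using r by auto
  qed
  have "x ` (T <+> box n a (k + \<delta>)) \<subseteq> graded_part n (k + \<delta>)"
    using T(1) graded_part_mult[OF g_gr, of _ k]
    by (auto simp: x_def box_def single_in_graded_part add.commute)
  from card_le_hilbert_function[OF id ind this]
  show "card (box n a (k + \<delta>)) + hilbert_function n I k \<le> hilbert_function n I (k + \<delta>)"
    using T(3) fT finite_box by (simp add: card_Plus hilbert_function_def)
qed

text \<open>The bounds are summed over all degrees. Far out, a window of \<open>\<delta>\<close>
  consecutive values of the Hilbert function has sum \<open>r * \<delta>\<close>, and
  \<open>\<delta>\<close> is also the last factor of the number of box monomials.\<close>

lemma scheme_length_ge:
  fixes I :: "'a::field_char_0 mpol set"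
  assumes I: "finite_subscheme n I" and ann: "I \<subseteq> annihilator n (single a 1)"
    and a: "\<And>i. i \<le> n \<Longrightarrow> lookup a i \<le> lookup a n"
  shows "(\<Prod>i<n. lookup a i + 1) \<le> scheme_length n I"
proof -
  obtain r where r: "\<forall>\<^sub>F k in sequentially. hilbert_function n I k = r" and cl: "closed_subscheme n I"
    using I by (auto simp: finite_subscheme_def)
  then obtain k0 where k0: "\<And>k. k \<ge> k0 \<Longrightarrow> hilbert_function n I k = r"
    by (auto simp: eventually_sequentially)
  \<comment> \<open>The least exponent for which all powers \<open>y_i ^ \<delta>\<close>,
    \<open>i \<le> n\<close>, annihilate the monomial.\<close>
  define \<delta> where "\<delta> = lookup a n + 1"
  have H: "hilbert_function n I k \<le> r" if "k \<ge> k0" for k using k0[OF that] by simp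
  obtain t where t: "\<And>k x. x \<in> graded_part n k \<Longrightarrow> (\<Sum>i\<le>n. scale (t i) (var i ^ \<delta>)) * x \<in> I \<Longrightarrow> x \<in> I"
    using generic_nonzerodivisor[OF cl H] by blast
  have a': "lookup a i < \<delta>" if "i \<le> n" for i using a[OF that] by (simp add: \<delta>_def)
  have bound: "card (box n a (k + \<delta>)) + hilbert_function n I k \<le> hilbert_function n I (k + \<delta>)"
    "card (box n a k) \<le> hilbert_function n I k" for k
    using card_box_le_hilbert_function[where t = t and k = k and \<delta> = \<delta>,
        OF closed_subschemeD(1)[OF cl] ann a' refl] t by blast+
  \<comment> \<open>Shifting the window by one drops the value at \<open>N\<close> and adds the one
    at \<open>N + \<delta>\<close>; by \<open>bound\<close> their difference covers the box in
    degree \<open>N + \<delta>\<close>.\<close>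
  have sum: "(\<Sum>k<N + \<delta>. card (box n a k)) \<le> (\<Sum>k=N..<N + \<delta>. hilbert_function n I k)" for N
  proof (induction N)
    case 0
    show ?case using bound(2) by (simp add: atLeast0LessThan sum_mono)
  next
    case (Suc N)
    have "(\<Sum>k=N..<N + \<delta>. hilbert_function n I k) + hilbert_function n I (N + \<delta>)
      = hilbert_function n I N + (\<Sum>k=Suc N..<Suc N + \<delta>. hilbert_function n I k)"
    proof -
      have "(\<Sum>k=N..<N + \<delta>. hilbert_function n I k) + hilbert_function n I (N + \<delta>)
        = (\<Sum>k=N..<Suc (N + \<delta>). hilbert_function n I k)" by simp
      also have "\<dots> = hilbert_function n I N + (\<Sum>k=Suc N..<Suc (N + \<delta>). hilbert_function n I k)"
        by (rule sum.atLeast_Suc_lessThan) simp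
      finally show ?thesis by simp
    qed
    then show ?case using Suc.IH bound(1)[of N] by simp
  qed
  \<comment> \<open>Large enough for the Hilbert function to be constant on the window and for the
    degrees below \<open>N + \<delta>\<close> to exhaust the box.\<close>
  define N where "N = k0 + (\<Sum>i\<le>n. lookup a i)"
  have "(\<Prod>i<n. lookup a i + 1) * \<delta> = (\<Prod>i\<le>n. lookup a i + 1)"
    by (simp add: \<delta>_def flip: lessThan_Suc_atMost)
  also have "\<dots> \<le> (\<Sum>k<N + \<delta>. card (box n a k))"
    by (rule prod_le_sum_card_box) (simp add: N_def \<delta>_def)
  also have "\<dots> \<le> (\<Sum>k=N..<N + \<delta>. hilbert_function n I k)" by (rule sum)
  also have "\<dots> = (\<Sum>k=N..<N + \<delta>. r)" by (intro sum.cong) (auto simp: k0 N_def)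
  also have "\<dots> = r * \<delta>" by simp
  finally have "(\<Prod>i<n. lookup a i + 1) \<le> r"
    by (rule mult_right_le_imp_le) (simp add: \<delta>_def)
  then show ?thesis unfolding scheme_length_eqI[OF r] .
qed

section \<open>The ranks of a monomial\<close>

lemma Inf_nat_eqI:
  fixes A :: "nat set"
  shows "x \<in> A \<Longrightarrow> (\<And>y. y \<in> A \<Longrightarrow> x \<le> y) \<Longrightarrow> Inf A = x"
  by (rule cInf_eq_minimum)

theorem corollary2:
  fixes n :: nat and d :: "nat \<Rightarrow> nat" and F :: "'k::field_char_0 mpol"
  assumes "\<And>i. i < n \<Longrightarrow> d i \<le> d (Suc i)"
    and "F = (\<Prod>i\<le>n. var i ^ d i)"
  shows "cactus_rank n F = smoothable_rank n F
       \<and> smoothable_rank n F = (\<Prod>i<n. (d i + 1))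
       \<and> (d n = d 0 \<longrightarrow>
            smooth_rank n F = cactus_rank n F
          \<and> cactus_rank n F = smoothable_rank n F
          \<and> smoothable_rank n F = (d 0 + 1) ^ n)"
proof -
  define a where "a = (\<Sum>i\<le>n. single i (d i))"
  have la: "lookup a i = (if i \<le> n then d i else 0)" for i
    unfolding a_def lookup_sum lookup_single when_def by (simp add: sum.delta')
  have "(\<Prod>i\<in>A. var i ^ d i) = (single (\<Sum>i\<in>A. single i (d i)) 1 :: 'k mpol)" if "finite A" for A
    using that by (induction A rule: finite_induct) (simp_all add: var_power mult_single)
  then have F: "F = single a 1" using assms(2) by (simp add: a_def)
  have mono: "d i \<le> d j" if "i \<le> j" "j \<le> n" for i j
    using that
  proof (induction j rule: dec_induct)
    case (step j)
    then show ?case using assms(1)[of j] by simp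
  qed simp
  \<comment> \<open>For \<open>i < n\<close>, \<open>y_i ^ e i\<close> is the smallest power of
    \<open>y_i\<close> that annihilates \<open>F\<close>.\<close>
  define e where "e = (\<lambda>i. lookup a i + 1)"
  define P where "P = (\<Prod>i<n. d i + 1)"
  have e: "\<And>i. i < n \<Longrightarrow> 0 < e i" by (simp add: e_def)
  have eP: "(\<Prod>i<n. e i) = P" by (simp add: P_def e_def la)
  have lower: "P \<le> scheme_length n I" if "finite_subscheme n I" "I \<subseteq> annihilator n F" for I
    using scheme_length_ge[of n I a] that mono by (simp add: F P_def la)
  let ?J = "\<lambda>c. binomial_ideal n e (c :: 'k)"
  have J: "finite_subscheme n (?J c)" "scheme_length n (?J c) = P" for c
    using finite_subscheme_binomial_ideal[of n e c] e eP by auto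
  have J0: "?J 0 \<subseteq> annihilator n F" "smoothable n (?J 0)"
    using binomial_ideal_subset_annihilator[of 0 n a e] smoothable_binomial_ideal[of n e] e
    by (auto simp: F e_def)
  have cr: "cactus_rank n F = P"
    unfolding cactus_rank_def
  proof (rule Inf_nat_eqI)
    show "P \<in> {scheme_length n I | I. finite_subscheme n I \<and> I \<subseteq> annihilator n F}"
      using J[of 0] J0 by (intro CollectI exI[of _ "?J 0"]) simp
  next
    fix y assume "y \<in> {scheme_length n I | I. finite_subscheme n I \<and> I \<subseteq> annihilator n F}"
    then show "P \<le> y" by (elim CollectE exE conjE) (simp only: lower)
  qed
  have sr: "smoothable_rank n F = P"
    unfolding smoothable_rank_def
  proof (rule Inf_nat_eqI)
    show "P \<in> {scheme_length n I | I. finite_subscheme n I \<and> smoothable n I \<and> I \<subseteq> annihilator n F}"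
      using J[of 0] J0 by (intro CollectI exI[of _ "?J 0"]) simp
  next
    fix y assume "y \<in> {scheme_length n I | I. finite_subscheme n I \<and> smoothable n I \<and> I \<subseteq> annihilator n F}"
    then show "P \<le> y" by (elim CollectE exE conjE) (simp only: lower)
  qed
  have "smooth_rank n F = P \<and> P = (d 0 + 1) ^ n" if eq: "d n = d 0"
  proof
    have di: "d i = d 0" if "i \<le> n" for i
      using mono[of 0 i] mono[of i n] eq that by simp
    \<comment> \<open>With equal exponents the last one is also minimal, so the smooth scheme with
      \<open>c = 1\<close> is apolar too.\<close>
    have "\<forall>i<n. lookup a n \<le> lookup a i"
      using mono[of 0] eq by (simp add: la)
    then have "?J 1 \<subseteq> annihilator n F"
      unfolding F using e_def by (rule binomial_ideal_subset_annihilator[OF disjI2])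
    moreover have "smooth_finite_subscheme n (?J 1)"
      using smooth_binomial_ideal[of n e 1] e by simp
    ultimately have J1: "P \<in> {scheme_length n I | I. smooth_finite_subscheme n I \<and> I \<subseteq> annihilator n F}"
      using J[of 1] by (intro CollectI exI[of _ "?J 1"]) simp
    show "smooth_rank n F = P"
      unfolding smooth_rank_def
    proof (rule Inf_nat_eqI[OF J1])
      fix y assume "y \<in> {scheme_length n I | I. smooth_finite_subscheme n I \<and> I \<subseteq> annihilator n F}"
      then show "P \<le> y"
        by (elim CollectE exE conjE) (simp only: lower smooth_finite_subscheme_def)
    qed
    have "P = (\<Prod>i<n. d 0 + 1)" unfolding P_def by (intro prod.cong refl arg_cong2[where f = "(+)"] di) simp
    then show "P = (d 0 + 1) ^ n" by simp
  qed
  then show ?thesis using cr sr by (simp add: P_def)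
qed

end
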